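(* Suppose $A$ is a noetherian (locally finite) $\mathbb{N}$-graded algebra over a field with $A_0$ semisimple. Let $0\neq X\in\mathbf{D}^-(\mathrm{gr}\,A)$ and let $P^\bullet$ be the minimal graded projective resolution of $X$, with differentials $d^{m}_{P^\bullet}\colon P^m\to P^{m+1}$. If $p=-\mathrm{inf.deg}(X)$, then there is some $P^{-\alpha}$ such that $P^{-\alpha}$ has an indecomposable direct summand generated by an element of degree $\alpha-p$ which is contained in $\ker d^{-\alpha}_{P^\bullet}$.
   Context: An $\mathbb{N}$-graded algebra $A=\bigoplus_{i\geqslant 0}A_i$ is always an algebra over a field that is locally finite: each $A_i$ is finite-dimensional. Noetherian means left and right noetherian. Modules are graded left modules. $\mathrm{gr}\,A$ is the category of finitely generated graded $A$-modules with degree-zero morphisms; $\mathbf{D}^-(\mathrm{gr}\,A)$ is its derived category of right bounded (bounded above) cochain complexes. $J$ is the graded Jacobson radical of $A$ (here $J=A_{\geqslant1}$, as $A_0$ is semisimple). A graded projective complex $(P^\bullet,d^\bullet)$ is minimal if $\mathrm{Im}\,d^m\subseteq JP^{m+1}$ for all $m$; every $X\in\mathbf{D}^-(\mathrm{gr}\,A)$ has a minimal graded projective resolution, i.e. a graded projective resolution that is a minimal complex. For a complex $X$ of graded modules, $\mathrm{inf.deg}(X)=\inf\{i+j\mid H^i(X)_j\neq 0,\ i,j\in\mathbb{Z}\}$. *)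

theory Defs
  imports "HOL-Algebra.AbelCoset" "HOL-Algebra.Module" "HOL-Library.Extended_Real"
begin

section \<open>Left modules over a possibly noncommutative ring\<close>

text \<open>The library locale \<^locale>\<open>Module.module\<close> assumes a commutative ring of scalars; the following
  has the same axioms over an arbitrary ring.  The module records of the library are reused, and their
  fields \<open>mult\<close> and \<open>one\<close> play no role for modules.  The library locale
  \<^locale>\<open>submodule\<close> does not need commutativity and is used as it is.\<close>

locale left_module = R?: ring R + M?: abelian_group M
  for R :: "('a, 'c) ring_scheme" (structure) and M :: "('a, 'm, 'd) module_scheme" (structure) +
  assumes lm_smult_closed:
      "\<lbrakk>a \<in> carrier R; x \<in> carrier M\<rbrakk> \<Longrightarrow> a \<odot>\<^bsub>M\<^esub> x \<in> carrier M"
    and lm_smult_l_distr: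
      "\<lbrakk>a \<in> carrier R; b \<in> carrier R; x \<in> carrier M\<rbrakk> \<Longrightarrow>
        (a \<oplus>\<^bsub>R\<^esub> b) \<odot>\<^bsub>M\<^esub> x = (a \<odot>\<^bsub>M\<^esub> x) \<oplus>\<^bsub>M\<^esub> (b \<odot>\<^bsub>M\<^esub> x)"
    and lm_smult_r_distr:
      "\<lbrakk>a \<in> carrier R; x \<in> carrier M; y \<in> carrier M\<rbrakk> \<Longrightarrow>
        a \<odot>\<^bsub>M\<^esub> (x \<oplus>\<^bsub>M\<^esub> y) = (a \<odot>\<^bsub>M\<^esub> x) \<oplus>\<^bsub>M\<^esub> (a \<odot>\<^bsub>M\<^esub> y)"
    and lm_smult_assoc:
      "\<lbrakk>a \<in> carrier R; b \<in> carrier R; x \<in> carrier M\<rbrakk> \<Longrightarrow>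
        (a \<otimes>\<^bsub>R\<^esub> b) \<odot>\<^bsub>M\<^esub> x = a \<odot>\<^bsub>M\<^esub> (b \<odot>\<^bsub>M\<^esub> x)"
    and lm_smult_one:
      "x \<in> carrier M \<Longrightarrow> \<one>\<^bsub>R\<^esub> \<odot>\<^bsub>M\<^esub> x = x"

definition gen_submodule ::
    "('a, 'c) ring_scheme \<Rightarrow> ('a, 'm, 'd) module_scheme \<Rightarrow> 'm set \<Rightarrow> 'm set" where
  "gen_submodule R M S = carrier M \<inter> \<Inter>{N. submodule N R M \<and> S \<subseteq> N}"

definition fin_gen :: "('a, 'c) ring_scheme \<Rightarrow> ('a, 'm, 'd) module_scheme \<Rightarrow> 'm set \<Rightarrow> bool" where
  "fin_gen R M N \<longleftrightarrow> (\<exists>S. finite S \<and> S \<subseteq> N \<and> N = gen_submodule R M S)"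

definition direct_sum_of :: "('m, 'd) ring_scheme \<Rightarrow> 'm set \<Rightarrow> 'm set \<Rightarrow> 'm set \<Rightarrow> bool" where
  "direct_sum_of M N N1 N2 \<longleftrightarrow> N1 \<inter> N2 = {\<zero>\<^bsub>M\<^esub>} \<and> N1 <+>\<^bsub>M\<^esub> N2 = N"

definition regular_module :: "('a, 'c) ring_scheme \<Rightarrow> ('a, 'a) module" where
  "regular_module R = \<lparr>carrier = carrier R, mult = mult R, one = one R,
     zero = zero R, add = add R, smult = mult R\<rparr>"

definition opposite_ring :: "('a, 'c) ring_scheme \<Rightarrow> ('a, 'c) ring_scheme" where
  "opposite_ring R = R\<lparr>mult := (\<lambda>x y. y \<otimes>\<^bsub>R\<^esub> x)\<rparr>"

definition left_noetherian :: "('a, 'c) ring_scheme \<Rightarrow> bool" where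
  "left_noetherian R \<longleftrightarrow>
     (\<forall>I. submodule I R (regular_module R) \<longrightarrow> fin_gen R (regular_module R) I)"

definition noetherian :: "('a, 'c) ring_scheme \<Rightarrow> bool" where
  "noetherian R \<longleftrightarrow> left_noetherian R \<and> left_noetherian (opposite_ring R)"

definition semisimple_ring :: "('a, 'c) ring_scheme \<Rightarrow> bool" where
  "semisimple_ring R \<longleftrightarrow> ring R \<and>
     (\<forall>I. submodule I R (regular_module R) \<longrightarrow>
        (\<exists>I'. submodule I' R (regular_module R) \<and> direct_sum_of R (carrier R) I I'))"


section \<open>Graded algebras and graded modules\<close>

text \<open>Internal direct sum decomposition of the additive group of \<open>M\<close>.\<close>

definition decomposes :: "('m, 'd) ring_scheme \<Rightarrow> ('i \<Rightarrow> 'm set) \<Rightarrow> bool" where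
  "decomposes M D \<longleftrightarrow> (\<forall>i. additive_subgroup (D i) M) \<and>
     (\<forall>x\<in>carrier M. \<exists>!f. (\<forall>i. f i \<in> D i) \<and> finite {i. f i \<noteq> \<zero>\<^bsub>M\<^esub>} \<and>
        x = (\<Oplus>\<^bsub>M\<^esub>i\<in>{i. f i \<noteq> \<zero>\<^bsub>M\<^esub>}. f i))"

text \<open>\<open>A\<close> is a locally finite algebra over the field \<open>K\<close>, graded by \<open>A = \<Oplus>i\<ge>0. G i\<close>.
  The ring operations and the \<open>K\<close>-vector space structure are both stored in the record \<open>A\<close>.\<close>

locale locally_finite_graded_algebra = K?: field K + A?: ring A + Module.module K A
  for K :: "('k, 'c) ring_scheme" (structure) and A :: "('k, 'a, 'd) module_scheme" (structure) +
  fixes G :: "nat \<Rightarrow> 'a set"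
  assumes smult_mult_left:
      "\<lbrakk>c \<in> carrier K; a \<in> carrier A; b \<in> carrier A\<rbrakk> \<Longrightarrow>
        (c \<odot>\<^bsub>A\<^esub> a) \<otimes>\<^bsub>A\<^esub> b = c \<odot>\<^bsub>A\<^esub> (a \<otimes>\<^bsub>A\<^esub> b)"
    and smult_mult_right:
      "\<lbrakk>c \<in> carrier K; a \<in> carrier A; b \<in> carrier A\<rbrakk> \<Longrightarrow>
        a \<otimes>\<^bsub>A\<^esub> (c \<odot>\<^bsub>A\<^esub> b) = c \<odot>\<^bsub>A\<^esub> (a \<otimes>\<^bsub>A\<^esub> b)"
    and graded_subspace: "submodule (G i) K A"
    and graded_decomposes: "decomposes A G"
    and graded_one: "\<one>\<^bsub>A\<^esub> \<in> G 0"
    and graded_mult: "\<lbrakk>a \<in> G i; b \<in> G j\<rbrakk> \<Longrightarrow> a \<otimes>\<^bsub>A\<^esub> b \<in> G (i + j)"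
    and locally_finite: "fin_gen K A (G i)"

record ('a, 'm) gmodule = "('a, 'm) module" +
  hpart :: "int \<Rightarrow> 'm set"

locale graded_left_module = left_module A M
  for A :: "('a, 'c) ring_scheme" and G :: "nat \<Rightarrow> 'a set" and M :: "('a, 'm) gmodule" +
  assumes hpart_decomposes: "decomposes M (hpart M)"
    and hpart_smult:
      "\<lbrakk>a \<in> G i; x \<in> hpart M j\<rbrakk> \<Longrightarrow> a \<odot>\<^bsub>M\<^esub> x \<in> hpart M (int i + j)"

text \<open>The objects and morphisms of the category of finitely generated graded modules.\<close>

definition gr_object :: "('a, 'c) ring_scheme \<Rightarrow> (nat \<Rightarrow> 'a set) \<Rightarrow> ('a, 'm) gmodule \<Rightarrow> bool" where
  "gr_object A G M \<longleftrightarrow> graded_left_module A G M \<and> fin_gen A M (carrier M)"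

definition gr_hom ::
    "('a, 'c) ring_scheme \<Rightarrow> ('a, 'm) gmodule \<Rightarrow> ('a, 'n) gmodule \<Rightarrow> ('m \<Rightarrow> 'n) set" where
  "gr_hom A M N = {f. f \<in> carrier M \<rightarrow> carrier N \<and>
     (\<forall>x\<in>carrier M. \<forall>y\<in>carrier M. f (x \<oplus>\<^bsub>M\<^esub> y) = f x \<oplus>\<^bsub>N\<^esub> f y) \<and>
     (\<forall>a\<in>carrier A. \<forall>x\<in>carrier M. f (a \<odot>\<^bsub>M\<^esub> x) = a \<odot>\<^bsub>N\<^esub> f x) \<and>
     (\<forall>j. f ` hpart M j \<subseteq> hpart N j)}"

definition graded_submodule :: "('a, 'c) ring_scheme \<Rightarrow> ('a, 'm) gmodule \<Rightarrow> 'm set \<Rightarrow> bool" where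
  "graded_submodule A M N \<longleftrightarrow>
     submodule N A M \<and> N = gen_submodule A M (N \<inter> (\<Union>j. hpart M j))"

definition graded_regular_module ::
    "('a, 'c) ring_scheme \<Rightarrow> (nat \<Rightarrow> 'a set) \<Rightarrow> ('a, 'a) gmodule" where
  "graded_regular_module A G = \<lparr>carrier = carrier A, mult = mult A, one = one A,
     zero = zero A, add = add A, smult = mult A,
     hpart = (\<lambda>j. if 0 \<le> j then G (nat j) else {\<zero>\<^bsub>A\<^esub>})\<rparr>"

definition maximal_graded_left_ideal ::
    "('a, 'c) ring_scheme \<Rightarrow> (nat \<Rightarrow> 'a set) \<Rightarrow> 'a set \<Rightarrow> bool" where
  "maximal_graded_left_ideal A G L \<longleftrightarrow>
     graded_submodule A (graded_regular_module A G) L \<and> L \<noteq> carrier A \<and>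
     (\<forall>L'. graded_submodule A (graded_regular_module A G) L' \<longrightarrow> L \<subseteq> L' \<longrightarrow>
        L' = L \<or> L' = carrier A)"

definition graded_jacobson_radical ::
    "('a, 'c) ring_scheme \<Rightarrow> (nat \<Rightarrow> 'a set) \<Rightarrow> 'a set" where
  "graded_jacobson_radical A G = carrier A \<inter> \<Inter>{L. maximal_graded_left_ideal A G L}"

text \<open>\<open>P\<close> is a projective object of the category of finitely generated graded modules: morphisms out of
  \<open>P\<close> lift along epimorphisms.  HOL cannot quantify over all element types of \<open>M\<close> and \<open>N\<close>
  inside the definition, but the two types used here suffice.  Every finite graded free module
  \<open>F\<close> (finite direct sum of shifts of \<open>A\<close>) has an isomorphic copy with elements in
  \<^typ>\<open>nat \<Rightarrow> 'a\<close>, and \<open>N = P\<close> is allowed; so some epimorphism \<open>F \<rightarrow> P\<close> splits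
  and the lifting property follows for modules over arbitrary element types.\<close>

definition graded_projective ::
    "('a, 'c) ring_scheme \<Rightarrow> (nat \<Rightarrow> 'a set) \<Rightarrow> ('a, 'p) gmodule \<Rightarrow> bool" where
  "graded_projective A G P \<longleftrightarrow> gr_object A G P \<and>
     (\<forall>(M :: ('a, nat \<Rightarrow> 'a) gmodule) (N :: ('a, 'p) gmodule) g f.
        gr_object A G M \<longrightarrow> gr_object A G N \<longrightarrow>
        g \<in> gr_hom A M N \<longrightarrow> g ` carrier M = carrier N \<longrightarrow> f \<in> gr_hom A P N \<longrightarrow>
        (\<exists>h\<in>gr_hom A P M. \<forall>x\<in>carrier P. g (h x) = f x))"

text \<open>Direct summands and indecomposability are taken in the graded category.\<close>

definition direct_summand :: "('a, 'c) ring_scheme \<Rightarrow> ('a, 'm) gmodule \<Rightarrow> 'm set \<Rightarrow> bool" where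
  "direct_summand A M Q \<longleftrightarrow> graded_submodule A M Q \<and>
     (\<exists>Q'. graded_submodule A M Q' \<and> direct_sum_of M (carrier M) Q Q')"

definition indecomposable :: "('a, 'c) ring_scheme \<Rightarrow> ('a, 'm) gmodule \<Rightarrow> 'm set \<Rightarrow> bool" where
  "indecomposable A M Q \<longleftrightarrow> graded_submodule A M Q \<and> Q \<noteq> {\<zero>\<^bsub>M\<^esub>} \<and>
     (\<forall>N1 N2. graded_submodule A M N1 \<longrightarrow> graded_submodule A M N2 \<longrightarrow> direct_sum_of M Q N1 N2 \<longrightarrow>
        N1 = {\<zero>\<^bsub>M\<^esub>} \<or> N2 = {\<zero>\<^bsub>M\<^esub>})"


section \<open>Complexes and the derived category\<close>

record ('a, 'm) gcomplex =
  obj :: "int \<Rightarrow> ('a, 'm) gmodule"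
  diff :: "int \<Rightarrow> 'm \<Rightarrow> 'm"

text \<open>Right bounded cochain complexes of finitely generated graded modules, i.e. the objects of the
  derived category \<open>D\<^sup>-(gr A)\<close>.\<close>

definition right_bounded_complex ::
    "('a, 'c) ring_scheme \<Rightarrow> (nat \<Rightarrow> 'a set) \<Rightarrow> ('a, 'm) gcomplex \<Rightarrow> bool" where
  "right_bounded_complex A G X \<longleftrightarrow>
     (\<forall>i. gr_object A G (obj X i)) \<and>
     (\<forall>i. diff X i \<in> gr_hom A (obj X i) (obj X (i + 1))) \<and>
     (\<forall>i. \<forall>x\<in>carrier (obj X i). diff X (i + 1) (diff X i x) = \<zero>\<^bsub>obj X (i + 2)\<^esub>) \<and>
     (\<exists>n. \<forall>i>n. carrier (obj X i) = {\<zero>\<^bsub>obj X i\<^esub>})"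

definition cocycles :: "('a, 'm) gcomplex \<Rightarrow> int \<Rightarrow> 'm set" where
  "cocycles X i = a_kernel (obj X i) (obj X (i + 1)) (diff X i)"

definition coboundaries :: "('a, 'm) gcomplex \<Rightarrow> int \<Rightarrow> 'm set" where
  "coboundaries X i = diff X (i - 1) ` carrier (obj X (i - 1))"

definition sub_gmodule :: "('a, 'm) gmodule \<Rightarrow> 'm set \<Rightarrow> ('a, 'm) gmodule" where
  "sub_gmodule M N = M\<lparr>carrier := N, hpart := (\<lambda>j. hpart M j \<inter> N)\<rparr>"

definition quotient_gmodule :: "('a, 'm) gmodule \<Rightarrow> 'm set \<Rightarrow> ('a, 'm set) gmodule" where
  "quotient_gmodule M N = \<lparr>carrier = a_rcosets\<^bsub>M\<^esub> N, mult = undefined, one = undefined,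
     zero = N, add = set_add M,
     smult = (\<lambda>a C. \<Union>x\<in>C. N +>\<^bsub>M\<^esub> (a \<odot>\<^bsub>M\<^esub> x)),
     hpart = (\<lambda>j. (\<lambda>x. N +>\<^bsub>M\<^esub> x) ` hpart M j)\<rparr>"

definition cohomology :: "('a, 'm) gcomplex \<Rightarrow> int \<Rightarrow> ('a, 'm set) gmodule" where
  "cohomology X i = quotient_gmodule (sub_gmodule (obj X i) (cocycles X i)) (coboundaries X i)"

definition cohomology_map ::
    "('a, 'y) gcomplex \<Rightarrow> (int \<Rightarrow> 'x \<Rightarrow> 'y) \<Rightarrow> int \<Rightarrow> 'x set \<Rightarrow> 'y set" where
  "cohomology_map Y f i C = (\<Union>x\<in>C. coboundaries Y i +>\<^bsub>obj Y i\<^esub> f i x)"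

definition chain_map ::
    "('a, 'c) ring_scheme \<Rightarrow> ('a, 'x) gcomplex \<Rightarrow> ('a, 'y) gcomplex \<Rightarrow> (int \<Rightarrow> 'x \<Rightarrow> 'y) \<Rightarrow> bool"
  where
  "chain_map A X Y f \<longleftrightarrow>
     (\<forall>i. f i \<in> gr_hom A (obj X i) (obj Y i)) \<and>
     (\<forall>i. \<forall>x\<in>carrier (obj X i). f (i + 1) (diff X i x) = diff Y i (f i x))"

definition quasi_isomorphism ::
    "('a, 'c) ring_scheme \<Rightarrow> ('a, 'x) gcomplex \<Rightarrow> ('a, 'y) gcomplex \<Rightarrow> (int \<Rightarrow> 'x \<Rightarrow> 'y) \<Rightarrow> bool"
  where
  "quasi_isomorphism A X Y f \<longleftrightarrow> chain_map A X Y f \<and>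
     (\<forall>i. bij_betw (cohomology_map Y f i) (carrier (cohomology X i)) (carrier (cohomology Y i)))"

definition zero_complex :: "('a, unit) gcomplex" where
  "zero_complex = \<lparr>obj = (\<lambda>_. \<lparr>carrier = {()}, mult = (\<lambda>_ _. ()), one = (), zero = (),
     add = (\<lambda>_ _. ()), smult = (\<lambda>_ _. ()), hpart = (\<lambda>_. {()})\<rparr>), diff = (\<lambda>_ _. ())\<rparr>"

text \<open>\<open>X\<close> is a zero object of the derived category iff the morphism from \<open>X\<close> to the zero complex becomes
  invertible there, i.e. iff this chain map is a quasi-isomorphism.\<close>

definition zero_in_derived :: "('a, 'c) ring_scheme \<Rightarrow> ('a, 'm) gcomplex \<Rightarrow> bool" where
  "zero_in_derived A X \<longleftrightarrow> quasi_isomorphism A X zero_complex (\<lambda>_ _. ())"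

text \<open>The value is \<open>\<infinity>\<close> if all cohomology vanishes, and \<open>-\<infinity>\<close> if the set is unbounded below.\<close>

definition inf_deg :: "('a, 'm) gcomplex \<Rightarrow> ereal" where
  "inf_deg X = Inf {ereal (real_of_int (i + j)) | i j.
     hpart (cohomology X i) j \<noteq> {\<zero>\<^bsub>cohomology X i\<^esub>}}"

text \<open>The submodule \<open>I M\<close> spanned by all products.\<close>

definition ideal_times ::
    "('a, 'c) ring_scheme \<Rightarrow> 'a set \<Rightarrow> ('a, 'm) gmodule \<Rightarrow> 'm set" where
  "ideal_times A I M = gen_submodule A M {a \<odot>\<^bsub>M\<^esub> x | a x. a \<in> I \<and> x \<in> carrier M}"

definition minimal_complex ::
    "('a, 'c) ring_scheme \<Rightarrow> (nat \<Rightarrow> 'a set) \<Rightarrow> ('a, 'p) gcomplex \<Rightarrow> bool" where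
  "minimal_complex A G P \<longleftrightarrow>
     (\<forall>m. diff P m ` carrier (obj P m)
        \<subseteq> ideal_times A (graded_jacobson_radical A G) (obj P (m + 1)))"

text \<open>A complex of projectives isomorphic to \<open>X\<close> in the derived category admits a quasi-isomorphism
  \<open>\<epsilon>\<close> to \<open>X\<close> by an honest chain map, since it is right bounded.\<close>

definition graded_projective_resolution ::
    "('a, 'c) ring_scheme \<Rightarrow> (nat \<Rightarrow> 'a set) \<Rightarrow> ('a, 'm) gcomplex \<Rightarrow> ('a, 'p) gcomplex \<Rightarrow>
      (int \<Rightarrow> 'p \<Rightarrow> 'm) \<Rightarrow> bool" where
  "graded_projective_resolution A G X P \<epsilon> \<longleftrightarrow> right_bounded_complex A G P \<and>
     (\<forall>i. graded_projective A G (obj P i)) \<and> quasi_isomorphism A P X \<epsilon>"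

end

theory Submission
  imports Defs
begin

text \<open>Minimality forces \<open>P\<^sup>m\<^sub>j = 0\<close> whenever \<open>m + j < -p\<close>, by descending induction on \<open>m\<close>: in the lowest
  nonzero degree \<open>j\<close> of \<open>P\<^sup>m\<close> the differential vanishes because its image lies in \<open>J P\<^sup>m\<^sup>+\<^sup>1\<close>, so every
  element there is a cocycle, hence a coboundary because \<open>H\<^sup>m(X)\<^sub>j = 0\<close>, hence lies in \<open>J P\<^sup>m\<close>, which is
  zero in degree \<open>j\<close>.  Since \<open>H(X)\<close> is nonzero in some total degree \<open>-p\<close>, there is a largest \<open>m\<close> with
  \<open>P\<^sup>m\<close> nonzero in degree \<open>j = -p - m\<close>; this is the lowest degree of \<open>P\<^sup>m\<close>, and \<open>P\<^sup>m\<^sup>+\<^sup>1\<close> vanishes in degrees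
  below \<open>j\<close>, so the differential is zero on \<open>P\<^sup>m\<^sub>j\<close>.  Finally, a simple \<open>A\<^sub>0\<close>-summand \<open>A\<^sub>0 y\<close> of \<open>P\<^sup>m\<^sub>j\<close> generates
  an indecomposable direct summand \<open>A y\<close> of the projective module \<open>P\<^sup>m\<close>.\<close>

section \<open>Homogeneous components\<close>

text \<open>Minimality alone does not make an element of total degree \<open>- p\<close> a cocycle:
  its differential could come from degree \<open>j - 1\<close> of
  \<open>P\<^sup>m\<^sup>+\<^sup>1\<close>, which again has total degree \<open>- p\<close>. The
  maximal choice of \<open>m\<close> excludes exactly this. Multiplication by \<open>J\<close>
  leaves the lowest degree because elements of \<open>J\<close> have no degree zero component; with
  \<open>J\<close> given by maximal graded left ideals, this needs semisimplicity of
  \<open>A\<^sub>0\<close>. Semisimplicity enters a second time to split \<open>A\<^sub>0 y\<close>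
  off the lowest part. The bridge between \<open>A\<^sub>0\<close> and \<open>A\<close> is that the
  projection of a graded module onto its lowest part is linear along
  \<open>a \<mapsto> a\<^sub>0\<close>: a scalar of positive degree could reach degree
  \<open>j\<close> only from a degree below \<open>j\<close>. So a splitting over
  \<open>A\<^sub>0\<close> becomes a morphism of graded \<open>A\<close>-modules, and projectivity
  lifts it to a splitting over \<open>A\<close>.\<close>

definition component :: "('m, 'd) ring_scheme \<Rightarrow> ('i \<Rightarrow> 'm set) \<Rightarrow> 'i \<Rightarrow> 'm \<Rightarrow> 'm" where
  "component M D i x = (THE f. (\<forall>i. f i \<in> D i) \<and> finite {i. f i \<noteq> \<zero>\<^bsub>M\<^esub>} \<and>
     x = (\<Oplus>\<^bsub>M\<^esub>i\<in>{i. f i \<noteq> \<zero>\<^bsub>M\<^esub>}. f i)) i"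

text \<open>The index type stays open so that the same facts serve the natural number grading of the
  ring and the integer grading of modules.\<close>

locale graded_group = abelian_group M for M (structure) +
  fixes D :: "'i \<Rightarrow> _ set"
  assumes decomposes: "decomposes M D"
begin

abbreviation comp where "comp \<equiv> component M D"

lemma part_subgroup: "additive_subgroup (D i) M"
  using decomposes by (simp add: decomposes_def)

lemma part_closed: "x \<in> D i \<Longrightarrow> x \<in> carrier M"
  using additive_subgroup.a_Hcarr[OF part_subgroup] .

lemma part_zero: "\<zero> \<in> D i"
  using additive_subgroup.zero_closed[OF part_subgroup] .

lemma part_add: "\<lbrakk>x \<in> D i; y \<in> D i\<rbrakk> \<Longrightarrow> x \<oplus> y \<in> D i"
  using additive_subgroup.a_closed[OF part_subgroup] .

lemma
  assumes "x \<in> carrier M"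
  shows component_part: "comp i x \<in> D i"
    and component_finite: "finite {i. comp i x \<noteq> \<zero>}"
    and component_sum: "x = (\<Oplus>i\<in>{i. comp i x \<noteq> \<zero>}. comp i x)"
proof -
  let ?Q = "\<lambda>f. (\<forall>i. f i \<in> D i) \<and> finite {i. f i \<noteq> \<zero>} \<and> x = (\<Oplus>i\<in>{i. f i \<noteq> \<zero>}. f i)"
  have "\<exists>!f. ?Q f"
    using decomposes assms by (simp add: decomposes_def)
  then have "?Q (THE f. ?Q f)"
    by (rule theI')
  moreover have "(THE f. ?Q f) = (\<lambda>i. comp i x)"
    by (simp add: component_def fun_eq_iff)
  ultimately have "?Q (\<lambda>i. comp i x)"
    by simp
  then show "comp i x \<in> D i" "finite {i. comp i x \<noteq> \<zero>}" "x = (\<Oplus>i\<in>{i. comp i x \<noteq> \<zero>}. comp i x)"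
    by auto
qed

lemma component_closed: "x \<in> carrier M \<Longrightarrow> comp i x \<in> carrier M"
  using component_part part_closed by blast

text \<open>Padding with zero terms does not change a sum, so \<open>I\<close> need only contain the
  support. This matters for sums of elements, where cancellation makes the true support smaller than
  the union of the two supports.\<close>

lemma component_unique:
  assumes "\<And>i. f i \<in> D i" "finite I" "\<And>i. i \<notin> I \<Longrightarrow> f i = \<zero>" "x = (\<Oplus>i\<in>I. f i)"
  shows "comp i x = f i"
proof -
  let ?Q = "\<lambda>f. (\<forall>i. f i \<in> D i) \<and> finite {i. f i \<noteq> \<zero>} \<and> x = (\<Oplus>i\<in>{i. f i \<noteq> \<zero>}. f i)"
  have clos: "f i \<in> carrier M" for i
    using assms(1) part_closed by blast
  have sub: "{i. f i \<noteq> \<zero>} \<subseteq> I"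
    using assms(3) by blast
  have fin: "finite {i. f i \<noteq> \<zero>}"
    using sub assms(2) by (rule finite_subset)
  have "(\<Oplus>i\<in>{i. f i \<noteq> \<zero>}. f i) = (\<Oplus>i\<in>I. f i)"
    by (rule add.finprod_mono_neutral_cong_left) (use clos sub assms(2) in auto)
  then have Qf: "?Q f"
    using assms fin by simp
  have x: "x \<in> carrier M"
    using assms(4) clos by (auto intro: finsum_closed)
  have "\<exists>!f. ?Q f"
    using decomposes x by (simp add: decomposes_def)
  then have "(THE f. ?Q f) = f"
    using Qf by (rule the1_equality[of ?Q f])
  then show ?thesis
    by (simp add: component_def)
qed

lemma component_homogeneous:
  assumes "x \<in> D i"
  shows "comp k x = (if k = i then x else \<zero>)"
proof (rule component_unique[where I = "{i}" and f = "\<lambda>k. if k = i then x else \<zero>"])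
  show "x = (\<Oplus>k\<in>{i}. if k = i then x else \<zero>)"
    using part_closed[OF assms] by simp
qed (use assms part_zero in auto)

lemma component_zero: "comp i \<zero> = \<zero>"
  using component_homogeneous[OF part_zero[of i], of i] by simp

lemma component_add:
  assumes x: "x \<in> carrier M" and y: "y \<in> carrier M"
  shows "comp i (x \<oplus> y) = comp i x \<oplus> comp i y"
proof (rule component_unique)
  let ?I = "{i. comp i x \<noteq> \<zero>} \<union> {i. comp i y \<noteq> \<zero>}"
  have cl: "comp i x \<in> carrier M" "comp i y \<in> carrier M" for i
    using x y by (auto intro: component_closed)
  show "comp i x \<oplus> comp i y \<in> D i" for i
    using x y by (intro part_add component_part)
  show fin: "finite ?I"
    using x y component_finite by simp
  show "comp i x \<oplus> comp i y = \<zero>" if "i \<notin> ?I" for i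
    using that by simp
  have "x = (\<Oplus>i\<in>?I. comp i x)"
    by (subst component_sum[OF x], rule add.finprod_mono_neutral_cong_left) (use fin cl in auto)
  moreover have "y = (\<Oplus>i\<in>?I. comp i y)"
    by (subst component_sum[OF y], rule add.finprod_mono_neutral_cong_left) (use fin cl in auto)
  moreover have "(\<Oplus>i\<in>?I. comp i x \<oplus> comp i y) = (\<Oplus>i\<in>?I. comp i x) \<oplus> (\<Oplus>i\<in>?I. comp i y)"
    by (rule finsum_addf) (use cl in auto)
  ultimately show "x \<oplus> y = (\<Oplus>i\<in>?I. comp i x \<oplus> comp i y)"
    by simp
qed

lemma finsum_in_closed_set:
  assumes "finite I" "\<And>i. i \<in> I \<Longrightarrow> f i \<in> S" "S \<subseteq> carrier M" "\<zero> \<in> S"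
    "\<And>x y. \<lbrakk>x \<in> S; y \<in> S\<rbrakk> \<Longrightarrow> x \<oplus> y \<in> S"
  shows "(\<Oplus>i\<in>I. f i) \<in> S"
  using assms(1,2)
proof (induction I)
  case (insert i I)
  then have "(\<Oplus>i\<in>insert i I. f i) = f i \<oplus> (\<Oplus>i\<in>I. f i)"
    using assms(3) by (intro finsum_insert) auto
  then show ?case
    using insert assms(5) by simp
qed (use assms(4) in simp)

text \<open>The working principle for everything below: an additive property needs checking on
  homogeneous elements only, and no explicit finite sum has to be handled again.\<close>

lemma graded_induct:
  assumes "x \<in> carrier M" "Q \<zero>" "\<And>i x. x \<in> D i \<Longrightarrow> Q x"
    "\<And>x y. \<lbrakk>x \<in> carrier M; y \<in> carrier M; Q x; Q y\<rbrakk> \<Longrightarrow> Q (x \<oplus> y)"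
  shows "Q x"
proof -
  have "(\<Oplus>i\<in>{i. comp i x \<noteq> \<zero>}. comp i x) \<in> {x \<in> carrier M. Q x}"
    using assms(2,4) assms(3)[OF component_part[OF assms(1)]] component_finite[OF assms(1)]
      component_closed[OF assms(1)]
    by (intro finsum_in_closed_set) auto
  then show ?thesis
    using component_sum[OF assms(1)] by simp
qed

end


section \<open>Submodules\<close>

context left_module
begin

lemma smult_zero_right: "a \<in> carrier R \<Longrightarrow> a \<odot>\<^bsub>M\<^esub> \<zero>\<^bsub>M\<^esub> = \<zero>\<^bsub>M\<^esub>"
  using lm_smult_r_distr[of a "\<zero>\<^bsub>M\<^esub>" "\<zero>\<^bsub>M\<^esub>"] lm_smult_closed[of a "\<zero>\<^bsub>M\<^esub>"]
  by (metis M.add.r_cancel_one' M.l_zero M.zero_closed)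

lemma smult_zero_left: "x \<in> carrier M \<Longrightarrow> \<zero>\<^bsub>R\<^esub> \<odot>\<^bsub>M\<^esub> x = \<zero>\<^bsub>M\<^esub>"
  using lm_smult_l_distr[of "\<zero>\<^bsub>R\<^esub>" "\<zero>\<^bsub>R\<^esub>" x] lm_smult_closed[of "\<zero>\<^bsub>R\<^esub>" x]
  by (metis M.add.r_cancel_one' R.l_zero R.zero_closed)

lemma smult_minus_left:
  assumes "a \<in> carrier R" "x \<in> carrier M"
  shows "(\<ominus>\<^bsub>R\<^esub> a) \<odot>\<^bsub>M\<^esub> x = \<ominus>\<^bsub>M\<^esub> (a \<odot>\<^bsub>M\<^esub> x)"
proof (rule M.minus_equality[symmetric])
  show "(\<ominus>\<^bsub>R\<^esub> a) \<odot>\<^bsub>M\<^esub> x \<oplus>\<^bsub>M\<^esub> a \<odot>\<^bsub>M\<^esub> x = \<zero>\<^bsub>M\<^esub>"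
    using assms lm_smult_l_distr[of "\<ominus>\<^bsub>R\<^esub> a" a x] by (simp add: R.l_neg smult_zero_left)
qed (use assms lm_smult_closed in auto)

text \<open>Closure under negatives comes for free, as the negative of \<open>x\<close> is the
  scalar \<open>-1\<close> times \<open>x\<close>.\<close>

lemma submodule_intro:
  assumes "N \<subseteq> carrier M" "\<zero>\<^bsub>M\<^esub> \<in> N" "\<And>x y. \<lbrakk>x \<in> N; y \<in> N\<rbrakk> \<Longrightarrow> x \<oplus>\<^bsub>M\<^esub> y \<in> N"
    "\<And>a x. \<lbrakk>a \<in> carrier R; x \<in> N\<rbrakk> \<Longrightarrow> a \<odot>\<^bsub>M\<^esub> x \<in> N"
  shows "submodule N R M"
proof -
  have "\<ominus>\<^bsub>M\<^esub> x \<in> N" if "x \<in> N" for x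
  proof -
    have "x \<in> carrier M"
      using that assms(1) by blast
    then have "\<ominus>\<^bsub>M\<^esub> x = (\<ominus>\<^bsub>R\<^esub> \<one>\<^bsub>R\<^esub>) \<odot>\<^bsub>M\<^esub> x"
      by (simp add: smult_minus_left lm_smult_one)
    then show ?thesis
      using assms(4) that by simp
  qed
  then have "subgroup N (add_monoid M)"
    using assms by (intro M.add.subgroupI) auto
  then show ?thesis
    using assms(4) by (simp add: submodule_def submodule_axioms_def)
qed

lemma
  assumes "submodule N R M"
  shows submodule_carrier: "N \<subseteq> carrier M"
    and submodule_mem: "x \<in> N \<Longrightarrow> x \<in> carrier M"
    and submodule_zero: "\<zero>\<^bsub>M\<^esub> \<in> N"
    and submodule_add: "\<lbrakk>x \<in> N; y \<in> N\<rbrakk> \<Longrightarrow> x \<oplus>\<^bsub>M\<^esub> y \<in> N"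
    and submodule_minus: "x \<in> N \<Longrightarrow> \<ominus>\<^bsub>M\<^esub> x \<in> N"
    and submodule_smult: "\<lbrakk>a \<in> carrier R; x \<in> N\<rbrakk> \<Longrightarrow> a \<odot>\<^bsub>M\<^esub> x \<in> N"
proof -
  have s: "subgroup N (add_monoid M)"
    using assms by (simp add: submodule_def)
  show "N \<subseteq> carrier M" "x \<in> N \<Longrightarrow> x \<in> carrier M"
    using subgroup.subset[OF s] by auto
  show "\<zero>\<^bsub>M\<^esub> \<in> N"
    using subgroup.one_closed[OF s] by simp
  show "\<lbrakk>x \<in> N; y \<in> N\<rbrakk> \<Longrightarrow> x \<oplus>\<^bsub>M\<^esub> y \<in> N"
    using subgroup.m_closed[OF s] by simp
  show "x \<in> N \<Longrightarrow> \<ominus>\<^bsub>M\<^esub> x \<in> N"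
    using subgroup.m_inv_closed[OF s] by (simp add: a_inv_def)
  show "\<lbrakk>a \<in> carrier R; x \<in> N\<rbrakk> \<Longrightarrow> a \<odot>\<^bsub>M\<^esub> x \<in> N"
    using submodule.smult_closed[OF assms] .
qed

lemma gen_submodule_least: "\<lbrakk>submodule N R M; S \<subseteq> N\<rbrakk> \<Longrightarrow> gen_submodule R M S \<subseteq> N"
  by (auto simp: gen_submodule_def)

lemma gen_submodule_superset: "S \<subseteq> carrier M \<Longrightarrow> S \<subseteq> gen_submodule R M S"
  by (auto simp: gen_submodule_def)

lemma gen_submodule_submodule: "submodule (gen_submodule R M S) R M"
  by (rule submodule_intro)
    (auto simp: gen_submodule_def lm_smult_closed submodule_zero submodule_add submodule_smult)

lemma submodule_cyclic:
  assumes "x \<in> carrier M"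
  shows "submodule ((\<lambda>a. a \<odot>\<^bsub>M\<^esub> x) ` carrier R) R M"
proof (rule submodule_intro)
  let ?N = "(\<lambda>a. a \<odot>\<^bsub>M\<^esub> x) ` carrier R"
  show "?N \<subseteq> carrier M"
    using assms lm_smult_closed by auto
  show "\<zero>\<^bsub>M\<^esub> \<in> ?N"
    using smult_zero_left[OF assms] by (metis R.zero_closed imageI)
  show "u \<oplus>\<^bsub>M\<^esub> v \<in> ?N" if "u \<in> ?N" "v \<in> ?N" for u v
    using that lm_smult_l_distr[OF _ _ assms, symmetric] by auto
  show "a \<odot>\<^bsub>M\<^esub> u \<in> ?N" if "a \<in> carrier R" "u \<in> ?N" for a u
    using that lm_smult_assoc[OF _ _ assms, symmetric] by auto
qed

lemma gen_submodule_singleton: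
  assumes "x \<in> carrier M"
  shows "gen_submodule R M {x} = (\<lambda>a. a \<odot>\<^bsub>M\<^esub> x) ` carrier R" (is "_ = ?N")
proof
  have "x \<in> ?N"
    using lm_smult_one[OF assms] by (metis R.one_closed imageI)
  then show "gen_submodule R M {x} \<subseteq> ?N"
    by (intro gen_submodule_least submodule_cyclic assms) auto
  show "?N \<subseteq> gen_submodule R M {x}"
    using gen_submodule_superset[of "{x}"] submodule_smult[OF gen_submodule_submodule] assms
    by auto
qed

lemma submodule_sum:
  assumes "submodule N R M" "submodule L R M"
  shows "submodule (N <+>\<^bsub>M\<^esub> L) R M"
proof (rule submodule_intro)
  note N = submodule_mem[OF assms(1)] and L = submodule_mem[OF assms(2)]
  show "N <+>\<^bsub>M\<^esub> L \<subseteq> carrier M"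
    using N L by (auto simp: set_add_def')
  show "\<zero>\<^bsub>M\<^esub> \<in> N <+>\<^bsub>M\<^esub> L"
    using submodule_zero[OF assms(1)] submodule_zero[OF assms(2)] 
    by (force simp: set_add_def')
  show "x \<oplus>\<^bsub>M\<^esub> y \<in> N <+>\<^bsub>M\<^esub> L" if x: "x \<in> N <+>\<^bsub>M\<^esub> L" and y: "y \<in> N <+>\<^bsub>M\<^esub> L" for x y
  proof -
    obtain n l where h: "n \<in> N" "l \<in> L" "x = n \<oplus>\<^bsub>M\<^esub> l"
      using x by (auto simp: set_add_def')
    moreover obtain n' l' where h': "n' \<in> N" "l' \<in> L" "y = n' \<oplus>\<^bsub>M\<^esub> l'"
      using y by (auto simp: set_add_def')
    ultimately have "x \<oplus>\<^bsub>M\<^esub> y = (n \<oplus>\<^bsub>M\<^esub> n') \<oplus>\<^bsub>M\<^esub> (l \<oplus>\<^bsub>M\<^esub> l')"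
      using N L by (simp add: M.a_ac)
    then show ?thesis
      using submodule_add[OF assms(1) h(1) h'(1)] submodule_add[OF assms(2) h(2) h'(2)]
      unfolding set_add_def' by blast
  qed
  show "a \<odot>\<^bsub>M\<^esub> x \<in> N <+>\<^bsub>M\<^esub> L" if a: "a \<in> carrier R" and x: "x \<in> N <+>\<^bsub>M\<^esub> L" for a x
  proof -
    obtain n l where h: "n \<in> N" "l \<in> L" "x = n \<oplus>\<^bsub>M\<^esub> l"
      using x by (auto simp: set_add_def')
    then have "a \<odot>\<^bsub>M\<^esub> x = a \<odot>\<^bsub>M\<^esub> n \<oplus>\<^bsub>M\<^esub> a \<odot>\<^bsub>M\<^esub> l"
      using N L a by (simp add: lm_smult_r_distr)
    then show ?thesis
      using submodule_smult[OF assms(1) a h(1)] submodule_smult[OF assms(2) a h(2)]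
      unfolding set_add_def' by blast
  qed
qed

lemma submodule_Int: "\<lbrakk>submodule N R M; submodule L R M\<rbrakk> \<Longrightarrow> submodule (N \<inter> L) R M"
  by (rule submodule_intro)
    (auto simp: submodule_mem submodule_zero submodule_add submodule_smult)

lemma mem_sum_left: "\<lbrakk>submodule N R M; submodule L R M; x \<in> N\<rbrakk> \<Longrightarrow> x \<in> N <+>\<^bsub>M\<^esub> L"
  using submodule_zero[of L] submodule_mem[of N x]
  by (force simp: set_add_def')

lemma mem_sum_right: "\<lbrakk>submodule N R M; submodule L R M; x \<in> L\<rbrakk> \<Longrightarrow> x \<in> N <+>\<^bsub>M\<^esub> L"
  using submodule_zero[of N] submodule_mem[of L x]
  by (force simp: set_add_def')

end


lemma (in left_module) submodule_Union_chain:
  assumes "C \<noteq> {}" "\<And>N. N \<in> C \<Longrightarrow> submodule N R M" "\<And>N L. \<lbrakk>N \<in> C; L \<in> C\<rbrakk> \<Longrightarrow> N \<subseteq> L \<or> L \<subseteq> N"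
  shows "submodule (\<Union>C) R M"
proof (rule submodule_intro)
  show "\<Union>C \<subseteq> carrier M" "\<zero>\<^bsub>M\<^esub> \<in> \<Union>C"
    using assms(1) submodule_mem[OF assms(2)] submodule_zero[OF assms(2)] by blast+
  show "x \<oplus>\<^bsub>M\<^esub> y \<in> \<Union>C" if xy: "x \<in> \<Union>C" "y \<in> \<Union>C" for x y
  proof -
    obtain N where "N \<in> C" "x \<in> N" "y \<in> N"
      using xy assms(3) by blast
    then show ?thesis
      using submodule_add[OF assms(2)] by blast
  qed
  show "a \<odot>\<^bsub>M\<^esub> x \<in> \<Union>C" if "a \<in> carrier R" "x \<in> \<Union>C" for a x
    using that submodule_smult[OF assms(2)] by blast
qed

lemma (in ring) regular_left_module: "left_module R (regular_module R)"
proof -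
  have "abelian_group (regular_module R)"
    by (rule abelian_groupI) (auto simp: regular_module_def a_ac intro: l_neg)
  then show ?thesis
    by (intro left_module.intro left_module_axioms.intro ring_axioms)
      (auto simp: regular_module_def l_distr r_distr m_assoc)
qed


section \<open>Modules over semisimple rings\<close>

context left_module
begin

text \<open>Carries complements from left ideals over to modules. The left ideal of all
  \<open>a\<close> with \<open>a w\<close> in \<open>U\<close> has a complement, and
  \<open>f\<close> is the component of \<open>1\<close> in it. If \<open>b f w\<close> lies in
  \<open>U\<close>, then \<open>b f\<close> lies in both left ideals, so it is zero.\<close>

lemma semisimple_cyclic_complement:
  assumes ss: "semisimple_ring R" and U: "submodule U R M" and w: "w \<in> carrier M" "w \<notin> U"
  obtains f u where "f \<in> carrier R" "u \<in> U" "w = u \<oplus>\<^bsub>M\<^esub> (f \<odot>\<^bsub>M\<^esub> w)" "f \<odot>\<^bsub>M\<^esub> w \<notin> U"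
    "\<And>b. \<lbrakk>b \<in> carrier R; b \<odot>\<^bsub>M\<^esub> (f \<odot>\<^bsub>M\<^esub> w) \<in> U\<rbrakk> \<Longrightarrow> b \<odot>\<^bsub>M\<^esub> (f \<odot>\<^bsub>M\<^esub> w) = \<zero>\<^bsub>M\<^esub>"
proof -
  interpret reg: left_module R "regular_module R"
    by (rule R.regular_left_module)
  let ?L = "{a \<in> carrier R. a \<odot>\<^bsub>M\<^esub> w \<in> U}"
  have "submodule ?L R (regular_module R)"
    by (rule reg.submodule_intro)
      (use w U in \<open>auto simp: regular_module_def smult_zero_left lm_smult_l_distr lm_smult_assoc
        intro: submodule_zero submodule_add submodule_smult\<close>)
  then obtain L' where L': "submodule L' R (regular_module R)"
      and sum: "direct_sum_of R (carrier R) ?L L'"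
    using ss by (auto simp: semisimple_ring_def)
  have "\<one>\<^bsub>R\<^esub> \<in> ?L <+>\<^bsub>R\<^esub> L'"
    using sum by (simp add: direct_sum_of_def)
  then obtain l f where lf: "l \<in> ?L" "f \<in> L'" "\<one>\<^bsub>R\<^esub> = l \<oplus>\<^bsub>R\<^esub> f"
    by (auto simp: set_add_def')
  have f: "f \<in> carrier R"
    using reg.submodule_mem[OF L' lf(2)] by (simp add: regular_module_def)
  have "w = (l \<oplus>\<^bsub>R\<^esub> f) \<odot>\<^bsub>M\<^esub> w"
    using lm_smult_one[OF w(1)] lf(3) by simp
  also have "\<dots> = (l \<odot>\<^bsub>M\<^esub> w) \<oplus>\<^bsub>M\<^esub> (f \<odot>\<^bsub>M\<^esub> w)"
    using lf(1) f w by (simp add: lm_smult_l_distr)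
  finally have eq: "w = (l \<odot>\<^bsub>M\<^esub> w) \<oplus>\<^bsub>M\<^esub> (f \<odot>\<^bsub>M\<^esub> w)" .
  have "f \<odot>\<^bsub>M\<^esub> w \<notin> U"
    using eq w(2) lf(1) submodule_add[OF U, of "l \<odot>\<^bsub>M\<^esub> w" "f \<odot>\<^bsub>M\<^esub> w"] by auto
  moreover have "b \<odot>\<^bsub>M\<^esub> (f \<odot>\<^bsub>M\<^esub> w) = \<zero>\<^bsub>M\<^esub>"
    if b: "b \<in> carrier R" "b \<odot>\<^bsub>M\<^esub> (f \<odot>\<^bsub>M\<^esub> w) \<in> U" for b
  proof -
    have "b \<otimes>\<^bsub>R\<^esub> f \<in> L'"
      using reg.submodule_smult[OF L' b(1) lf(2)] by (simp add: regular_module_def)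
    moreover have "b \<otimes>\<^bsub>R\<^esub> f \<in> ?L"
      using b f w by (simp add: lm_smult_assoc)
    ultimately have "b \<otimes>\<^bsub>R\<^esub> f = \<zero>\<^bsub>R\<^esub>"
      using sum unfolding direct_sum_of_def by blast
    then show ?thesis
      using b f w by (simp add: lm_smult_assoc[symmetric] smult_zero_left)
  qed
  ultimately show ?thesis
    using that[of f "l \<odot>\<^bsub>M\<^esub> w"] f lf(1) eq by blast
qed

text \<open>A submodule \<open>W\<close> maximal among those avoiding \<open>z\<close> has a complement, which is simple because every
  submodule strictly above \<open>W\<close> contains \<open>z\<close>.\<close>

lemma semisimple_simple_summand:
  assumes ss: "semisimple_ring R" and z: "z \<in> carrier M" "z \<noteq> \<zero>\<^bsub>M\<^esub>"
  obtains W y where "submodule W R M" "z \<notin> W" "y \<in> carrier M" "y \<notin> W"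
    "W <+>\<^bsub>M\<^esub> (\<lambda>a. a \<odot>\<^bsub>M\<^esub> y) ` carrier R = carrier M"
    "W \<inter> (\<lambda>a. a \<odot>\<^bsub>M\<^esub> y) ` carrier R = {\<zero>\<^bsub>M\<^esub>}"
    "\<forall>T. submodule T R M \<longrightarrow> T \<subseteq> (\<lambda>a. a \<odot>\<^bsub>M\<^esub> y) ` carrier R \<longrightarrow> T \<noteq> {\<zero>\<^bsub>M\<^esub>} \<longrightarrow> y \<in> T"
proof -
  let ?F = "{N. submodule N R M \<and> z \<notin> N}"
  have "submodule {\<zero>\<^bsub>M\<^esub>} R M"
    by (rule submodule_intro) (auto simp: smult_zero_right)
  then have "?F \<noteq> {}"
    using z by blast
  moreover have "\<Union>C \<in> ?F" if "C \<noteq> {}" "subset.chain ?F C" for C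
  proof -
    have "submodule (\<Union>C) R M"
      by (rule submodule_Union_chain) (use that in \<open>auto simp: subset.chain_def\<close>)
    then show ?thesis
      using that by (auto simp: subset.chain_def)
  qed
  ultimately obtain W where W: "submodule W R M" "z \<notin> W"
      and max: "\<And>N. \<lbrakk>submodule N R M; z \<notin> N; W \<subseteq> N\<rbrakk> \<Longrightarrow> N = W"
    using subset_Zorn_nonempty[of ?F] by auto
  \<comment> \<open>The cyclic complement of \<open>W\<close> inside \<open>W + R z\<close> is
    already a complement of \<open>W\<close> in the whole module, as shown next.\<close>
  obtain e u where e: "e \<in> carrier R" "u \<in> W" "z = u \<oplus>\<^bsub>M\<^esub> (e \<odot>\<^bsub>M\<^esub> z)" "e \<odot>\<^bsub>M\<^esub> z \<notin> W"
      and e0: "\<And>b. \<lbrakk>b \<in> carrier R; b \<odot>\<^bsub>M\<^esub> (e \<odot>\<^bsub>M\<^esub> z) \<in> W\<rbrakk> \<Longrightarrow> b \<odot>\<^bsub>M\<^esub> (e \<odot>\<^bsub>M\<^esub> z) = \<zero>\<^bsub>M\<^esub>"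
    using semisimple_cyclic_complement[OF ss W(1) z(1) W(2)] by blast
  define y where "y = e \<odot>\<^bsub>M\<^esub> z"
  let ?Y = "(\<lambda>a. a \<odot>\<^bsub>M\<^esub> y) ` carrier R"
  have y: "y \<in> carrier M"
    using e z by (simp add: y_def lm_smult_closed)
  have Y: "submodule ?Y R M"
    by (rule submodule_cyclic[OF y])
  have yY: "y \<in> ?Y"
    using lm_smult_one[OF y] by (metis R.one_closed imageI)
  have int: "x = \<zero>\<^bsub>M\<^esub>" if "x \<in> W" "x \<in> ?Y" for x
    using that e0 by (auto simp: y_def)
  let ?U = "W <+>\<^bsub>M\<^esub> ?Y"
  have U: "submodule ?U R M"
    by (rule submodule_sum[OF W(1) Y])
  have zU: "z \<in> ?U"
    using e(2,3) yY unfolding set_add_def' y_def by blast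
  \<comment> \<open>A \<open>w\<close> outside \<open>?U\<close> would yield a cyclic
    \<open>?V\<close>, not inside \<open>W\<close>, that meets \<open>?U\<close> only in zero. By
    maximality \<open>z\<close> lies in \<open>W + ?V\<close>, but it also lies in
    \<open>?U\<close>; so its part in \<open>?V\<close> vanishes and \<open>z\<close> falls into
    \<open>W\<close>.\<close>
  have "w \<in> ?U" if w: "w \<in> carrier M" for w
  proof (rule ccontr)
    assume wU: "w \<notin> ?U"
    obtain f v where f: "f \<in> carrier R" "v \<in> ?U" "w = v \<oplus>\<^bsub>M\<^esub> (f \<odot>\<^bsub>M\<^esub> w)" "f \<odot>\<^bsub>M\<^esub> w \<notin> ?U"
      and f0: "\<And>b. \<lbrakk>b \<in> carrier R; b \<odot>\<^bsub>M\<^esub> (f \<odot>\<^bsub>M\<^esub> w) \<in> ?U\<rbrakk> \<Longrightarrow> b \<odot>\<^bsub>M\<^esub> (f \<odot>\<^bsub>M\<^esub> w) = \<zero>\<^bsub>M\<^esub>"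
      using semisimple_cyclic_complement[OF ss U w wU] by blast
    let ?V = "(\<lambda>a. a \<odot>\<^bsub>M\<^esub> (f \<odot>\<^bsub>M\<^esub> w)) ` carrier R"
    have fw: "f \<odot>\<^bsub>M\<^esub> w \<in> carrier M"
      using f w by (simp add: lm_smult_closed)
    have V: "submodule ?V R M"
      by (rule submodule_cyclic[OF fw])
    have "f \<odot>\<^bsub>M\<^esub> w \<in> ?V"
      using lm_smult_one[OF fw] by (metis R.one_closed imageI)
    then have "f \<odot>\<^bsub>M\<^esub> w \<in> W <+>\<^bsub>M\<^esub> ?V"
      by (rule mem_sum_right[OF W(1) V])
    moreover have "f \<odot>\<^bsub>M\<^esub> w \<notin> W"
      using f(4) mem_sum_left[OF W(1) Y] by blast
    ultimately have "z \<in> W <+>\<^bsub>M\<^esub> ?V"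
      using max[OF submodule_sum[OF W(1) V]] mem_sum_left[OF W(1) V] by blast
    then obtain w1 b where wb: "w1 \<in> W" "b \<in> carrier R" "z = w1 \<oplus>\<^bsub>M\<^esub> (b \<odot>\<^bsub>M\<^esub> (f \<odot>\<^bsub>M\<^esub> w))"
      by (auto simp: set_add_def')
    have w1: "w1 \<in> carrier M"
      using submodule_mem[OF W(1) wb(1)] .
    have bfw: "b \<odot>\<^bsub>M\<^esub> (f \<odot>\<^bsub>M\<^esub> w) \<in> carrier M"
      using wb fw by (simp add: lm_smult_closed)
    have "b \<odot>\<^bsub>M\<^esub> (f \<odot>\<^bsub>M\<^esub> w) = (\<ominus>\<^bsub>M\<^esub> w1) \<oplus>\<^bsub>M\<^esub> z"
      using w1 bfw wb(3) by (simp add: M.r_neg1)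
    also have "\<dots> \<in> ?U"
      using submodule_add[OF U mem_sum_left[OF W(1) Y submodule_minus[OF W(1) wb(1)]] zU] .
    finally have "b \<odot>\<^bsub>M\<^esub> (f \<odot>\<^bsub>M\<^esub> w) = \<zero>\<^bsub>M\<^esub>"
      using f0 wb(2) by blast
    then show False
      using wb w1 W(2) by simp
  qed
  then have "?U = carrier M"
    using submodule_carrier[OF U] by blast
  moreover have "W \<inter> ?Y = {\<zero>\<^bsub>M\<^esub>}"
    using int submodule_zero[OF W(1)] submodule_zero[OF Y] by blast
  \<comment> \<open>By maximality \<open>z\<close> lies in \<open>W + T\<close>. Comparing
    \<open>z = w + t'\<close> with \<open>z = u + y\<close> puts \<open>y - t'\<close> into both
    \<open>W\<close> and \<open>?Y\<close>, so \<open>y = t'\<close>.\<close>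
  moreover have "y \<in> T" if T: "submodule T R M" "T \<subseteq> ?Y" "T \<noteq> {\<zero>\<^bsub>M\<^esub>}" for T
  proof -
    obtain t where t: "t \<in> T" "t \<noteq> \<zero>\<^bsub>M\<^esub>"
      using T(3) submodule_zero[OF T(1)] by blast
    then have "t \<notin> W"
      using int T(2) by blast
    then have "z \<in> W <+>\<^bsub>M\<^esub> T"
      using max[OF submodule_sum[OF W(1) T(1)]] mem_sum_left[OF W(1) T(1)]
        mem_sum_right[OF W(1) T(1) t(1)] by blast
    then obtain w t' where wt: "w \<in> W" "t' \<in> T" "z = w \<oplus>\<^bsub>M\<^esub> t'"
      by (auto simp: set_add_def')
    have c: "w \<in> carrier M" "t' \<in> carrier M" "u \<in> carrier M"
      using wt e(2) submodule_mem[OF W(1)] submodule_mem[OF T(1)] by auto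
    have eq: "u \<oplus>\<^bsub>M\<^esub> y = w \<oplus>\<^bsub>M\<^esub> t'"
      using wt(3) e(3) by (simp add: y_def)
    have "y \<ominus>\<^bsub>M\<^esub> t' = (\<ominus>\<^bsub>M\<^esub> u) \<oplus>\<^bsub>M\<^esub> (u \<oplus>\<^bsub>M\<^esub> y) \<ominus>\<^bsub>M\<^esub> t'"
      using c y by (simp add: M.r_neg1)
    also have "\<dots> = (\<ominus>\<^bsub>M\<^esub> u) \<oplus>\<^bsub>M\<^esub> w"
      unfolding eq using c by (simp add: M.minus_eq M.a_assoc M.r_neg)
    finally have 1: "y \<ominus>\<^bsub>M\<^esub> t' = (\<ominus>\<^bsub>M\<^esub> u) \<oplus>\<^bsub>M\<^esub> w" .
    have "y \<ominus>\<^bsub>M\<^esub> t' \<in> W"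
      unfolding 1 using submodule_add[OF W(1) submodule_minus[OF W(1) e(2)] wt(1)] .
    moreover have "y \<ominus>\<^bsub>M\<^esub> t' \<in> ?Y"
      unfolding M.minus_eq
      using submodule_add[OF Y yY submodule_minus[OF Y]] wt(2) T(2) by blast
    ultimately have "y \<ominus>\<^bsub>M\<^esub> t' = \<zero>\<^bsub>M\<^esub>"
      using int by blast
    moreover have "y = (y \<ominus>\<^bsub>M\<^esub> t') \<oplus>\<^bsub>M\<^esub> t'"
      using c y by (simp add: M.minus_eq M.a_assoc M.l_neg)
    ultimately show ?thesis
      using wt(2) c by simp
  qed
  ultimately show ?thesis
    using that[OF W y] e(4) by (simp add: y_def)
qed

end


section \<open>Graded rings and modules\<close>

locale graded_ring = ring A for A :: "('a, 'c) ring_scheme" +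
  fixes G :: "nat \<Rightarrow> 'a set"
  assumes ring_decomposes: "decomposes A G"
    and one_part: "\<one>\<^bsub>A\<^esub> \<in> G 0"
    and mult_part: "\<lbrakk>a \<in> G i; b \<in> G j\<rbrakk> \<Longrightarrow> a \<otimes>\<^bsub>A\<^esub> b \<in> G (i + j)"

sublocale graded_ring \<subseteq> RG: graded_group A G
  by unfold_locales (rule ring_decomposes)

locale graded_module = graded_ring A G + graded_left_module A G M
  for A :: "('a, 'c) ring_scheme" and G :: "nat \<Rightarrow> 'a set" and M :: "('a, 'm) gmodule"

sublocale graded_module \<subseteq> MG: graded_group M "hpart M"
  by unfold_locales (rule hpart_decomposes)

context graded_module
begin

lemma component_smult:
  assumes a: "a \<in> G k" and x: "x \<in> carrier M"
  shows "MG.comp n (a \<odot>\<^bsub>M\<^esub> x) = a \<odot>\<^bsub>M\<^esub> MG.comp (n - int k) x"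
proof -
  have ac: "a \<in> carrier A"
    using RG.part_closed[OF a] .
  show ?thesis
    using x
  proof (rule MG.graded_induct)
    show "MG.comp n (a \<odot>\<^bsub>M\<^esub> \<zero>\<^bsub>M\<^esub>) = a \<odot>\<^bsub>M\<^esub> MG.comp (n - int k) \<zero>\<^bsub>M\<^esub>"
      using ac by (simp add: MG.component_zero smult_zero_right)
    show "MG.comp n (a \<odot>\<^bsub>M\<^esub> x) = a \<odot>\<^bsub>M\<^esub> MG.comp (n - int k) x" if "x \<in> hpart M i" for i x
    proof -
      have "n = int k + i \<longleftrightarrow> n - int k = i"
        by linarith
      then show ?thesis
        using MG.component_homogeneous[OF hpart_smult[OF a that], of n]
          MG.component_homogeneous[OF that, of "n - int k"] ac
        by (simp add: smult_zero_right)
    qed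
  qed (simp add: ac lm_smult_closed lm_smult_r_distr MG.component_add MG.component_closed)
qed

text \<open>A homogeneous scalar of degree \<open>k > 0\<close> contributes to degree
  \<open>j\<close> only through the component of \<open>x\<close> in degree \<open>j - k\<close>,
  which is zero. Hence the lowest part is a quotient of \<open>M\<close> on which \<open>A\<close>
  acts through \<open>A\<^sub>0\<close>.\<close>

lemma component_smult_lowest:
  assumes low: "\<And>i. i < j \<Longrightarrow> hpart M i = {\<zero>\<^bsub>M\<^esub>}" and a: "a \<in> carrier A" and x: "x \<in> carrier M"
  shows "MG.comp j (a \<odot>\<^bsub>M\<^esub> x) = RG.comp 0 a \<odot>\<^bsub>M\<^esub> MG.comp j x"
  using a
proof (rule RG.graded_induct)
  have c: "MG.comp i x \<in> carrier M" for i
    using MG.component_closed[OF x] .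
  show "MG.comp j (\<zero>\<^bsub>A\<^esub> \<odot>\<^bsub>M\<^esub> x) = RG.comp 0 \<zero>\<^bsub>A\<^esub> \<odot>\<^bsub>M\<^esub> MG.comp j x"
    using x c by (simp add: RG.component_zero MG.component_zero smult_zero_left)
  show "MG.comp j (a \<odot>\<^bsub>M\<^esub> x) = RG.comp 0 a \<odot>\<^bsub>M\<^esub> MG.comp j x" if "a \<in> G k" for k a
  proof (cases "k = 0")
    case True
    then show ?thesis
      using component_smult[OF that x] RG.component_homogeneous[OF that] by simp
  next
    case False
    then have "MG.comp (j - int k) x = \<zero>\<^bsub>M\<^esub>"
      using low[of "j - int k"] MG.component_part[OF x, of "j - int k"] by simp
    then show ?thesis
      using False component_smult[OF that x] RG.component_homogeneous[OF that] RG.part_closed[OF that] c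
      by (simp add: smult_zero_left smult_zero_right)
  qed
  show "MG.comp j ((a \<oplus>\<^bsub>A\<^esub> b) \<odot>\<^bsub>M\<^esub> x) = RG.comp 0 (a \<oplus>\<^bsub>A\<^esub> b) \<odot>\<^bsub>M\<^esub> MG.comp j x"
    if "a \<in> carrier A" "b \<in> carrier A" "MG.comp j (a \<odot>\<^bsub>M\<^esub> x) = RG.comp 0 a \<odot>\<^bsub>M\<^esub> MG.comp j x"
      "MG.comp j (b \<odot>\<^bsub>M\<^esub> x) = RG.comp 0 b \<odot>\<^bsub>M\<^esub> MG.comp j x" for a b
    using that x c by (simp add: lm_smult_l_distr lm_smult_closed MG.component_add RG.component_add
        RG.component_closed)
qed

text \<open>Gradedness is defined by generation from homogeneous elements; closure under components
  suffices because each element is the sum of its components.\<close>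

lemma graded_submoduleI:
  assumes N: "submodule N A M" and comp: "\<And>x i. x \<in> N \<Longrightarrow> MG.comp i x \<in> N"
  shows "graded_submodule A M N"
proof -
  let ?H = "gen_submodule A M (N \<inter> (\<Union>j. hpart M j))"
  have H: "submodule ?H A M"
    by (rule gen_submodule_submodule)
  have "x \<in> ?H" if x: "x \<in> N" for x
  proof -
    have xM: "x \<in> carrier M"
      using submodule_mem[OF N x] .
    have "(\<Oplus>\<^bsub>M\<^esub>i\<in>{i. MG.comp i x \<noteq> \<zero>\<^bsub>M\<^esub>}. MG.comp i x) \<in> ?H"
    proof (rule MG.finsum_in_closed_set)
      show "MG.comp i x \<in> ?H" for i
        using gen_submodule_superset[of "N \<inter> (\<Union>j. hpart M j)"] comp[OF x]
          MG.component_part[OF xM] submodule_carrier[OF N] by blast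
    qed (use MG.component_finite[OF xM] submodule_carrier[OF H] submodule_zero[OF H]
          submodule_add[OF H] in auto)
    then show ?thesis
      using MG.component_sum[OF xM] by simp
  qed
  moreover have "?H \<subseteq> N"
    by (rule gen_submodule_least[OF N]) simp
  ultimately show ?thesis
    using N by (auto simp: graded_submodule_def)
qed

text \<open>Finitely many generators have finitely many nonzero components, and scalars never lower
  degrees. So the elements without components below a bound for the generators form a submodule,
  which is everything.\<close>

lemma bounded_below:
  assumes "fin_gen A M (carrier M)"
  obtains b where "\<And>i. i < b \<Longrightarrow> hpart M i = {\<zero>\<^bsub>M\<^esub>}"
proof -
  obtain S where S: "finite S" "S \<subseteq> carrier M" "carrier M = gen_submodule A M S"
    using assms by (auto simp: fin_gen_def)
  have "finite (\<Union>s\<in>S. {i. MG.comp i s \<noteq> \<zero>\<^bsub>M\<^esub>})"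
    using S(1,2) MG.component_finite by blast
  from bdd_below_finite[OF this]
  obtain b where b: "\<And>i. i \<in> (\<Union>s\<in>S. {i. MG.comp i s \<noteq> \<zero>\<^bsub>M\<^esub>}) \<Longrightarrow> b \<le> i"
    unfolding bdd_below_def by blast
  let ?N = "{x \<in> carrier M. \<forall>i<b. MG.comp i x = \<zero>\<^bsub>M\<^esub>}"
  have "submodule ?N A M"
  proof (rule submodule_intro)
    show "a \<odot>\<^bsub>M\<^esub> x \<in> ?N" if a: "a \<in> carrier A" and x: "x \<in> ?N" for a x
      using a
    proof (rule RG.graded_induct)
      have xM: "x \<in> carrier M"
        using x by simp
      show "a \<odot>\<^bsub>M\<^esub> x \<in> ?N" if "a \<in> G k" for a k
        using component_smult[OF that xM] x RG.part_closed[OF that]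
        by (simp add: lm_smult_closed smult_zero_right)
      show "\<zero>\<^bsub>A\<^esub> \<odot>\<^bsub>M\<^esub> x \<in> ?N"
        using xM by (simp add: smult_zero_left MG.component_zero)
      show "(a \<oplus>\<^bsub>A\<^esub> b) \<odot>\<^bsub>M\<^esub> x \<in> ?N"
        if "a \<in> carrier A" "b \<in> carrier A" "a \<odot>\<^bsub>M\<^esub> x \<in> ?N" "b \<odot>\<^bsub>M\<^esub> x \<in> ?N" for a b
        using that xM by (simp add: lm_smult_l_distr MG.component_add)
    qed
  qed (auto simp: MG.component_zero MG.component_add)
  moreover have "S \<subseteq> ?N"
  proof
    fix s assume s: "s \<in> S"
    have "MG.comp i s = \<zero>\<^bsub>M\<^esub>" if "i < b" for i
      using b[of i] s that by fastforce
    then show "s \<in> ?N"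
      using S(2) s by blast
  qed
  ultimately have N: "carrier M \<subseteq> ?N"
    unfolding S(3) by (rule gen_submodule_least)
  have "hpart M i = {\<zero>\<^bsub>M\<^esub>}" if "i < b" for i
  proof -
    have "x = \<zero>\<^bsub>M\<^esub>" if "x \<in> hpart M i" for x
      using N MG.part_closed[OF that] MG.component_homogeneous[OF that, of i] \<open>i < b\<close> by force
    then show ?thesis
      using MG.part_zero by blast
  qed
  then show ?thesis
    using that by blast
qed

lemma left_module_part:
  assumes "ring (A\<lparr>carrier := G 0\<rparr>)"
  shows "left_module (A\<lparr>carrier := G 0\<rparr>) (M\<lparr>carrier := hpart M j\<rparr>)"
proof -
  note Rc = RG.part_closed[of _ 0] and Mc = MG.part_closed[of _ j]
  have "abelian_group (M\<lparr>carrier := hpart M j\<rparr>)"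
  proof (rule abelian_groupI)
    show "\<exists>y\<in>carrier (M\<lparr>carrier := hpart M j\<rparr>). y \<oplus>\<^bsub>M\<lparr>carrier := hpart M j\<rparr>\<^esub> x = \<zero>\<^bsub>M\<lparr>carrier := hpart M j\<rparr>\<^esub>"
      if "x \<in> carrier (M\<lparr>carrier := hpart M j\<rparr>)" for x
      using that additive_subgroup.a_inv_closed[OF MG.part_subgroup] Mc
      by (auto intro!: bexI[of _ "\<ominus>\<^bsub>M\<^esub> x"] M.l_neg)
  qed (auto simp: MG.part_zero MG.part_add Mc M.a_ac)
  then show ?thesis
    using hpart_smult[of _ 0 _ j]
    by (intro left_module.intro left_module_axioms.intro assms)
      (auto simp: Rc Mc lm_smult_l_distr lm_smult_r_distr lm_smult_assoc lm_smult_one)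
qed

end


section \<open>Construction of gradings and the shifted regular modules\<close>

lemma (in abelian_group) additive_subgroup_intro:
  assumes "H \<subseteq> carrier G" "\<zero> \<in> H" "\<And>x y. \<lbrakk>x \<in> H; y \<in> H\<rbrakk> \<Longrightarrow> x \<oplus> y \<in> H"
    "\<And>x. x \<in> H \<Longrightarrow> \<ominus> x \<in> H"
  shows "additive_subgroup H G"
  using assms by (intro additive_subgroupI add.subgroupI) auto

text \<open>The maps \<open>\<pi> i\<close> are candidate projections. Uniqueness of the
  decomposition is automatic: additivity and the values on homogeneous elements force
  \<open>\<pi> k\<close> to pick the term \<open>f k\<close> out of any finite sum.\<close>

lemma (in abelian_group) decomposesI:
  assumes sub: "\<And>i. additive_subgroup (D i) G"
    and part: "\<And>i x. x \<in> carrier G \<Longrightarrow> \<pi> i x \<in> D i"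
    and add: "\<And>i x y. \<lbrakk>x \<in> carrier G; y \<in> carrier G\<rbrakk> \<Longrightarrow> \<pi> i (x \<oplus> y) = \<pi> i x \<oplus> \<pi> i y"
    and hom: "\<And>i k x. x \<in> D k \<Longrightarrow> \<pi> i x = (if i = k then x else \<zero>)"
    and sum: "\<And>x. x \<in> carrier G \<Longrightarrow>
      \<exists>I. finite I \<and> (\<forall>i. i \<notin> I \<longrightarrow> \<pi> i x = \<zero>) \<and> x = (\<Oplus>i\<in>I. \<pi> i x)"
  shows "decomposes G D"
  unfolding decomposes_def
proof (intro conjI allI ballI sub)
  fix x assume x: "x \<in> carrier G"
  note Dc = additive_subgroup.a_Hcarr[OF sub]
  let ?Q = "\<lambda>f. (\<forall>i. f i \<in> D i) \<and> finite {i. f i \<noteq> \<zero>} \<and> x = (\<Oplus>i\<in>{i. f i \<noteq> \<zero>}. f i)"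
  obtain I where I: "finite I" "\<And>i. i \<notin> I \<Longrightarrow> \<pi> i x = \<zero>" "x = (\<Oplus>i\<in>I. \<pi> i x)"
    using sum[OF x] by blast
  have sI: "{i. \<pi> i x \<noteq> \<zero>} \<subseteq> I"
    using I(2) by blast
  have "(\<Oplus>i\<in>{i. \<pi> i x \<noteq> \<zero>}. \<pi> i x) = (\<Oplus>i\<in>I. \<pi> i x)"
    by (rule add.finprod_mono_neutral_cong_left) (use I(1) sI Dc[OF part[OF x]] in auto)
  then have ex: "?Q (\<lambda>i. \<pi> i x)"
    using part[OF x] finite_subset[OF sI I(1)] I(3) by simp
  have un: "f = (\<lambda>i. \<pi> i x)" if f: "?Q f" for f
  proof
    fix k
    have fc: "f i \<in> carrier G" for i
      using f Dc by blast
    have "\<pi> k (\<Oplus>i\<in>J. f i) = (if k \<in> J then f k else \<zero>)" if "finite J" for J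
      using that
    proof (induction J)
      case empty
      then show ?case
        using hom[of \<zero> k k] additive_subgroup.zero_closed[OF sub] by simp
    next
      case (insert i J)
      have "(\<Oplus>i\<in>insert i J. f i) = f i \<oplus> (\<Oplus>i\<in>J. f i)"
        using insert fc by (intro finsum_insert) auto
      moreover have "(\<Oplus>i\<in>J. f i) \<in> carrier G"
        using fc by (intro finsum_closed) auto
      ultimately have "\<pi> k (\<Oplus>i\<in>insert i J. f i) = \<pi> k (f i) \<oplus> \<pi> k (\<Oplus>i\<in>J. f i)"
        using add fc by simp
      also have "\<dots> = (if k = i then f i else \<zero>) \<oplus> (if k \<in> J then f k else \<zero>)"
        using hom[of "f i" i k] f insert.IH by simp
      finally show ?case
        using fc insert.hyps by auto
    qed
    from this[of "{i. f i \<noteq> \<zero>}"] show "f k = \<pi> k x"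
      using f by (metis (mono_tags, lifting) mem_Collect_eq)
  qed
  show "\<exists>!f. ?Q f"
    by (rule ex1I[of ?Q, OF ex un])
qed

text \<open>The module \<open>A(-j)\<close> with elements encoded by \<open>\<iota>\<close> and decoded by \<open>\<kappa>\<close>: the lifting property in
  \<^const>\<open>graded_projective\<close> only tests modules over \<^typ>\<open>nat \<Rightarrow> 'a\<close>.\<close>

definition shifted_regular ::
    "('a, 'c) ring_scheme \<Rightarrow> (nat \<Rightarrow> 'a set) \<Rightarrow> ('a \<Rightarrow> 'b) \<Rightarrow> ('b \<Rightarrow> 'a) \<Rightarrow> int \<Rightarrow> ('a, 'b) gmodule" where
  "shifted_regular A G \<iota> \<kappa> j = \<lparr>carrier = \<iota> ` carrier A, mult = (\<lambda>x y. \<iota> (\<kappa> x \<otimes>\<^bsub>A\<^esub> \<kappa> y)),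
     one = \<iota> \<one>\<^bsub>A\<^esub>, zero = \<iota> \<zero>\<^bsub>A\<^esub>, add = (\<lambda>x y. \<iota> (\<kappa> x \<oplus>\<^bsub>A\<^esub> \<kappa> y)),
     smult = (\<lambda>a x. \<iota> (a \<otimes>\<^bsub>A\<^esub> \<kappa> x)),
     hpart = (\<lambda>i. \<iota> ` (if j \<le> i then G (nat (i - j)) else {\<zero>\<^bsub>A\<^esub>}))\<rparr>"

text \<open>Lets one verification of the module axioms serve both the lifting argument and the
  graded left ideals behind the radical.\<close>

lemma shifted_regular_id: "shifted_regular A G (\<lambda>a. a) (\<lambda>a. a) 0 = graded_regular_module A G"
  by (simp add: shifted_regular_def graded_regular_module_def fun_eq_iff)

context graded_ring
begin

text \<open>Two natural degrees add up to zero only if both are zero, so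
  \<open>a \<mapsto> a\<^sub>0\<close> is multiplicative. This is what makes modules on which
  \<open>A\<close> acts through \<open>A\<^sub>0\<close> associative.\<close>

lemma component_zero_mult:
  assumes "a \<in> carrier A" "b \<in> carrier A"
  shows "RG.comp 0 (a \<otimes>\<^bsub>A\<^esub> b) = RG.comp 0 a \<otimes>\<^bsub>A\<^esub> RG.comp 0 b"
  using assms(1)
proof (rule RG.graded_induct)
  fix k a assume a: "a \<in> G k"
  note ac = RG.part_closed[OF a]
  show "RG.comp 0 (a \<otimes>\<^bsub>A\<^esub> b) = RG.comp 0 a \<otimes>\<^bsub>A\<^esub> RG.comp 0 b"
    using assms(2)
  proof (rule RG.graded_induct)
    show "RG.comp 0 (a \<otimes>\<^bsub>A\<^esub> b) = RG.comp 0 a \<otimes>\<^bsub>A\<^esub> RG.comp 0 b" if "b \<in> G l" for b l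
      using ac RG.part_closed[OF that] RG.component_homogeneous[OF mult_part[OF a that]]
        RG.component_homogeneous[OF a] RG.component_homogeneous[OF that] by simp
  qed (use ac in \<open>simp_all add: r_distr RG.component_add RG.component_zero RG.component_closed\<close>)
qed (use assms(2) in \<open>simp_all add: l_distr RG.component_add RG.component_zero RG.component_closed\<close>)

lemma shifted_regular_graded_module:
  assumes \<kappa>: "\<And>a. \<kappa> (\<iota> a) = a"
  shows "graded_module A G (shifted_regular A G \<iota> \<kappa> j)" (is "graded_module A G ?S")
proof -
  note S = shifted_regular_def
  have "abelian_group ?S"
  proof (rule abelian_groupI)
    show "\<exists>y\<in>carrier ?S. y \<oplus>\<^bsub>?S\<^esub> x = \<zero>\<^bsub>?S\<^esub>" if x: "x \<in> carrier ?S" for x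
    proof -
      obtain a where "a \<in> carrier A" "x = \<iota> a"
        using x by (auto simp: S)
      then show ?thesis
        by (intro bexI[of _ "\<iota> (\<ominus>\<^bsub>A\<^esub> a)"]) (auto simp: S \<kappa> l_neg)
    qed
  qed (auto simp: S \<kappa> a_ac)
  then interpret S: left_module A ?S
    by (intro left_module.intro left_module_axioms.intro ring_axioms)
      (auto simp: S \<kappa> l_distr r_distr m_assoc)
  have minus: "\<ominus>\<^bsub>?S\<^esub> (\<iota> a) = \<iota> (\<ominus>\<^bsub>A\<^esub> a)" if "a \<in> carrier A" for a
    using that by (intro S.M.minus_equality) (auto simp: S \<kappa> l_neg)
  have sum: "finsum ?S (\<lambda>i. \<iota> (f i)) I = \<iota> (finsum A f I)"
    if "finite I" "\<And>i. f i \<in> carrier A" for I :: "'i set" and f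
    using that(1)
  proof (induction I)
    case empty
    show ?case
      by (subst S.M.finsum_empty) (simp add: S)
  next
    case (insert i I)
    have "finsum ?S (\<lambda>i. \<iota> (f i)) (insert i I) = \<iota> (f i) \<oplus>\<^bsub>?S\<^esub> finsum ?S (\<lambda>i. \<iota> (f i)) I"
      using insert that(2) by (intro S.M.finsum_insert) (auto simp: S)
    also have "\<dots> = \<iota> (f i \<oplus>\<^bsub>A\<^esub> finsum A f I)"
      unfolding insert.IH by (simp add: S \<kappa>)
    also have "f i \<oplus>\<^bsub>A\<^esub> finsum A f I = finsum A f (insert i I)"
      using insert that(2) by (intro finsum_insert[symmetric]) auto
    finally show ?case .
  qed
  \<comment> \<open>The guard \<open>j \<le> i\<close> is essential: \<open>nat\<close> truncates,
    so below \<open>j\<close> the formula would otherwise return the degree zero component.\<close>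
  let ?\<pi> = "\<lambda>i x. \<iota> (if j \<le> i then RG.comp (nat (i - j)) (\<kappa> x) else \<zero>\<^bsub>A\<^esub>)"
  have "decomposes ?S (hpart ?S)"
  proof (rule S.M.decomposesI[where \<pi> = ?\<pi>])
    show "additive_subgroup (hpart ?S i) ?S" for i
    proof (rule S.M.additive_subgroup_intro)
      show "hpart ?S i \<subseteq> carrier ?S" "\<zero>\<^bsub>?S\<^esub> \<in> hpart ?S i"
        using RG.part_closed RG.part_zero by (auto simp: S)
      show "x \<oplus>\<^bsub>?S\<^esub> y \<in> hpart ?S i" if "x \<in> hpart ?S i" "y \<in> hpart ?S i" for x y
        using that RG.part_add by (auto simp: S \<kappa> split: if_splits)
      show "\<ominus>\<^bsub>?S\<^esub> x \<in> hpart ?S i" if x: "x \<in> hpart ?S i" for x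
      proof -
        obtain a where "x = \<iota> a" "a \<in> (if j \<le> i then G (nat (i - j)) else {\<zero>\<^bsub>A\<^esub>})"
          using x by (auto simp: S)
        then show ?thesis
          using minus[of a] RG.part_closed additive_subgroup.a_inv_closed[OF RG.part_subgroup]
          by (auto simp: S split: if_splits)
      qed
    qed
    show "?\<pi> i x \<in> hpart ?S i" if "x \<in> carrier ?S" for i x
      using that RG.component_part by (auto simp: S \<kappa>)
    show "?\<pi> i (x \<oplus>\<^bsub>?S\<^esub> y) = ?\<pi> i x \<oplus>\<^bsub>?S\<^esub> ?\<pi> i y" if "x \<in> carrier ?S" "y \<in> carrier ?S" for i x y
      using that RG.component_add by (auto simp: S \<kappa>)
    show "?\<pi> i x = (if i = k then x else \<zero>\<^bsub>?S\<^esub>)" if x: "x \<in> hpart ?S k" for i k x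
    proof -
      obtain a where a: "x = \<iota> a" "a \<in> (if j \<le> k then G (nat (k - j)) else {\<zero>\<^bsub>A\<^esub>})"
        using x by (auto simp: S)
      show ?thesis
      proof (cases "j \<le> k")
        case True
        then have "a \<in> G (nat (k - j))"
          using a by simp
        then show ?thesis
          using True by (auto simp: a S \<kappa> RG.component_homogeneous eq_nat_nat_iff)
      next
        case False
        then show ?thesis
          using a by (auto simp: S \<kappa> RG.component_zero)
      qed
    qed
    show "\<exists>I. finite I \<and> (\<forall>i. i \<notin> I \<longrightarrow> ?\<pi> i x = \<zero>\<^bsub>?S\<^esub>) \<and> x = (\<Oplus>\<^bsub>?S\<^esub>i\<in>I. ?\<pi> i x)"
      if x: "x \<in> carrier ?S" for x
    proof -
      obtain a where a: "x = \<iota> a" "a \<in> carrier A"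
        using x by (auto simp: S)
      let ?N = "{n. RG.comp n a \<noteq> \<zero>\<^bsub>A\<^esub>}"
      let ?c = "\<lambda>i. if j \<le> i then RG.comp (nat (i - j)) a else \<zero>\<^bsub>A\<^esub>"
      let ?I = "(\<lambda>n. j + int n) ` ?N"
      have fin: "finite ?I"
        using RG.component_finite[OF a(2)] by simp
      have zero: "?c i = \<zero>\<^bsub>A\<^esub>" if "i \<notin> ?I" for i
      proof (rule ccontr)
        assume "?c i \<noteq> \<zero>\<^bsub>A\<^esub>"
        then have "nat (i - j) \<in> ?N" "i = j + int (nat (i - j))"
          by (auto split: if_splits)
        then show False
          using that by blast
      qed
      have "finsum A ?c ?I = finsum A (\<lambda>n. ?c (j + int n)) ?N"
        by (rule finsum_reindex) (use a RG.component_closed in \<open>auto simp: inj_on_def\<close>)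
      also have "\<dots> = a"
        using RG.component_sum[OF a(2)] by simp
      finally have "finsum A ?c ?I = a" .
      then have x_sum: "x = (\<Oplus>\<^bsub>?S\<^esub>i\<in>?I. \<iota> (?c i))"
        using a sum[OF fin, of ?c] RG.component_closed[OF a(2)] by simp
      have px: "?\<pi> i x = \<iota> (?c i)" for i
        by (simp add: a \<kappa>)
      show ?thesis
      proof (intro exI[of _ ?I] conjI allI impI fin)
        show "?\<pi> i x = \<zero>\<^bsub>?S\<^esub>" if "i \<notin> ?I" for i
          unfolding px zero[OF that] by (simp add: S)
        show "x = (\<Oplus>\<^bsub>?S\<^esub>i\<in>?I. ?\<pi> i x)"
          unfolding px by (rule x_sum)
      qed
    qed
  qed
  moreover have "a \<odot>\<^bsub>?S\<^esub> x \<in> hpart ?S (int i + k)" if a: "a \<in> G i" and x: "x \<in> hpart ?S k" for a i x k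
  proof (cases "j \<le> k")
    case True
    then obtain b where b: "x = \<iota> b" "b \<in> G (nat (k - j))"
      using x by (auto simp: S)
    have "nat (int i + k - j) = i + nat (k - j)"
      using True by simp
    then show ?thesis
      using mult_part[OF a b(2)] True b(1) by (auto simp: S \<kappa>)
  next
    case False
    then show ?thesis
      using x RG.part_closed[OF a] RG.part_zero by (auto simp: S \<kappa>)
  qed
  ultimately show ?thesis
    by (intro graded_module.intro graded_left_module.intro graded_left_module_axioms.intro
        graded_ring_axioms S.left_module_axioms)
qed

lemma shifted_regular_fin_gen:
  assumes \<kappa>: "\<And>a. \<kappa> (\<iota> a) = a"
  shows "fin_gen A (shifted_regular A G \<iota> \<kappa> j) (carrier (shifted_regular A G \<iota> \<kappa> j))"
proof -
  note S = shifted_regular_def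
  let ?S = "shifted_regular A G \<iota> \<kappa> j"
  interpret S: graded_module A G ?S
    using \<kappa> by (rule shifted_regular_graded_module)
  have c: "\<iota> \<one>\<^bsub>A\<^esub> \<in> carrier ?S"
    by (simp add: S)
  have "gen_submodule A ?S {\<iota> \<one>\<^bsub>A\<^esub>} = (\<lambda>a. a \<odot>\<^bsub>?S\<^esub> \<iota> \<one>\<^bsub>A\<^esub>) ` carrier A"
    by (rule S.gen_submodule_singleton[OF c])
  also have "\<dots> = carrier ?S"
    by (auto simp: S \<kappa>)
  finally show ?thesis
    unfolding fin_gen_def using c by (intro exI[of _ "{\<iota> \<one>\<^bsub>A\<^esub>}"]) auto
qed

end

section \<open>Graded submodules and the lowest degree\<close>

context graded_module
begin

lemma submodule_part:
  assumes "ring (A\<lparr>carrier := G 0\<rparr>)" "submodule N A M"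
  shows "submodule (N \<inter> hpart M j) (A\<lparr>carrier := G 0\<rparr>) (M\<lparr>carrier := hpart M j\<rparr>)"
  by (rule left_module.submodule_intro[OF left_module_part[OF assms(1)]])
    (use assms(2) hpart_smult[of _ 0 _ j] RG.part_closed MG.part_zero MG.part_add in
      \<open>auto simp: submodule_zero submodule_add submodule_smult\<close>)

context
  fixes j
  assumes R0: "ring (A\<lparr>carrier := G 0\<rparr>)"
    and low: "\<And>i. i < j \<Longrightarrow> hpart M i = {\<zero>\<^bsub>M\<^esub>}"
begin

text \<open>This is \<open>W\<close> plus all of \<open>M\<close> above degree \<open>j\<close>. It
  is stable under \<open>A\<close> because scalars act on the \<open>j\<close>-th component through
  \<open>A\<^sub>0\<close>.\<close>

lemma graded_submodule_lowest_preimage: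
  assumes W: "submodule W (A\<lparr>carrier := G 0\<rparr>) (M\<lparr>carrier := hpart M j\<rparr>)"
  shows "graded_submodule A M {x \<in> carrier M. MG.comp j x \<in> W}" (is "graded_submodule A M ?N")
proof -
  interpret P: left_module "A\<lparr>carrier := G 0\<rparr>" "M\<lparr>carrier := hpart M j\<rparr>"
    by (rule left_module_part[OF R0])
  have z: "\<zero>\<^bsub>M\<^esub> \<in> W"
    using P.submodule_zero[OF W] by simp
  show ?thesis
  proof (rule graded_submoduleI)
    show "submodule ?N A M"
      using z P.submodule_add[OF W] P.submodule_smult[OF W] RG.component_part
      by (intro submodule_intro)
        (auto simp: MG.component_zero MG.component_add component_smult_lowest[OF low] lm_smult_closed)
    show "MG.comp i x \<in> ?N" if "x \<in> ?N" for x i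
      using that z MG.component_closed MG.component_homogeneous[OF MG.component_part]
      by auto
  qed
qed

text \<open>Since gradedness is defined by generation, closure under components has to be derived.
  The elements whose \<open>j\<close>-th component lies in \<open>N\<close> form a submodule
  containing the homogeneous elements of \<open>N\<close>, hence all of \<open>N\<close>.\<close>

lemma graded_submodule_component_lowest:
  assumes N: "graded_submodule A M N" and x: "x \<in> N"
  shows "MG.comp j x \<in> N"
proof -
  have sN: "submodule N A M"
    using N by (simp add: graded_submodule_def)
  let ?T = "{x \<in> carrier M. MG.comp j x \<in> N}"
  have "submodule ?T A M"
    using submodule_zero[OF sN] submodule_add[OF sN] submodule_smult[OF sN] RG.component_closed
    by (intro submodule_intro)
      (auto simp: MG.component_zero MG.component_add component_smult_lowest[OF low] lm_smult_closed)
  moreover have "N \<inter> (\<Union>j. hpart M j) \<subseteq> ?T"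
    using submodule_mem[OF sN] submodule_zero[OF sN] by (auto simp: MG.component_homogeneous)
  ultimately have "gen_submodule A M (N \<inter> (\<Union>j. hpart M j)) \<subseteq> ?T"
    by (rule gen_submodule_least)
  then show ?thesis
    using N x unfolding graded_submodule_def by blast
qed

end

end

text \<open>A maximal left ideal \<open>W\<close> of \<open>A\<^sub>0\<close> avoiding \<open>a\<^sub>0 \<noteq> 0\<close> yields the maximal graded left ideal
  \<open>W + A\<^sub>\<ge>\<^sub>1\<close>, which avoids \<open>a\<close>.\<close>

lemma (in graded_ring) component_zero_radical:
  assumes ss: "semisimple_ring (A\<lparr>carrier := G 0\<rparr>)" and a: "a \<in> graded_jacobson_radical A G"
  shows "RG.comp 0 a = \<zero>\<^bsub>A\<^esub>"
proof (rule ccontr)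
  assume nz: "RG.comp 0 a \<noteq> \<zero>\<^bsub>A\<^esub>"
  let ?S = "graded_regular_module A G"
  let ?B = "A\<lparr>carrier := G 0\<rparr>"
  let ?D = "?S\<lparr>carrier := hpart ?S 0\<rparr>"
  note S = graded_regular_module_def
  interpret S: graded_module A G ?S
    using shifted_regular_graded_module[of "\<lambda>a. a" "\<lambda>a. a" 0] by (simp add: shifted_regular_id)
  have R0: "ring ?B"
    using ss by (simp add: semisimple_ring_def)
  interpret P: left_module ?B ?D
    by (rule S.left_module_part[OF R0])
  have low: "hpart ?S i = {\<zero>\<^bsub>?S\<^esub>}" if "i < 0" for i
    using that by (simp add: S)
  have part0: "hpart ?S 0 = G 0" and car: "carrier ?S = carrier A" and zero: "\<zero>\<^bsub>?S\<^esub> = \<zero>\<^bsub>A\<^esub>"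
    and add: "add ?S = add A"
    by (simp_all add: S)
  \<comment> \<open>The ring carries two gradings, by natural numbers as a ring and by integers as a
    module over itself; their projections to degree zero must be identified.\<close>
  have comp: "S.MG.comp 0 x = RG.comp 0 x" if "x \<in> carrier A" for x
    using that
  proof (rule RG.graded_induct)
    show "S.MG.comp 0 x = RG.comp 0 x" if "x \<in> G k" for x k
    proof -
      have "x \<in> hpart ?S (int k)"
        using that by (simp add: S)
      then show ?thesis
        using that by (simp add: RG.component_homogeneous S.MG.component_homogeneous zero)
    qed
    show "S.MG.comp 0 \<zero>\<^bsub>A\<^esub> = RG.comp 0 \<zero>\<^bsub>A\<^esub>"
      using S.MG.component_zero[of 0] RG.component_zero by (simp add: zero)
    show "S.MG.comp 0 (x \<oplus>\<^bsub>A\<^esub> y) = RG.comp 0 (x \<oplus>\<^bsub>A\<^esub> y)"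
      if "x \<in> carrier A" "y \<in> carrier A" "S.MG.comp 0 x = RG.comp 0 x" "S.MG.comp 0 y = RG.comp 0 y"
      for x y
      using that S.MG.component_add[of x y 0] RG.component_add[of x y 0] by (simp add: car add)
  qed
  have ac: "a \<in> carrier A"
    using a by (simp add: graded_jacobson_radical_def)
  have "RG.comp 0 a \<in> carrier ?D" "RG.comp 0 a \<noteq> \<zero>\<^bsub>?D\<^esub>"
    using RG.component_part[OF ac] nz by (simp_all add: part0 zero)
  then obtain W y where W: "submodule W ?B ?D" "RG.comp 0 a \<notin> W" "y \<in> carrier ?D" "y \<notin> W"
    and WY: "W <+>\<^bsub>?D\<^esub> (\<lambda>a. a \<odot>\<^bsub>?D\<^esub> y) ` carrier ?B = carrier ?D"
    and "W \<inter> (\<lambda>a. a \<odot>\<^bsub>?D\<^esub> y) ` carrier ?B = {\<zero>\<^bsub>?D\<^esub>}"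
    and simple: "\<forall>T. submodule T ?B ?D \<longrightarrow> T \<subseteq> (\<lambda>a. a \<odot>\<^bsub>?D\<^esub> y) ` carrier ?B \<longrightarrow> T \<noteq> {\<zero>\<^bsub>?D\<^esub>} \<longrightarrow> y \<in> T"
    by (rule P.semisimple_simple_summand[OF ss])
  let ?Y = "(\<lambda>a. a \<odot>\<^bsub>?D\<^esub> y) ` carrier ?B"
  let ?L = "{x \<in> carrier ?S. S.MG.comp 0 x \<in> W}"
  have Y: "submodule ?Y ?B ?D"
    by (rule P.submodule_cyclic[OF W(3)])
  have gL: "graded_submodule A ?S ?L"
    using low by (rule S.graded_submodule_lowest_preimage[OF R0 _ W(1)])
  have "maximal_graded_left_ideal A G ?L"
    unfolding maximal_graded_left_ideal_def
  proof (intro conjI allI impI gL)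
    show "?L \<noteq> carrier A"
    proof -
      have "a \<notin> ?L"
        using W(2) comp[OF ac] by simp
      then show ?thesis
        using ac by blast
    qed
    fix L' assume L': "graded_submodule A ?S L'" "?L \<subseteq> L'"
    have sL': "submodule L' A ?S"
      using L'(1) by (simp add: graded_submodule_def)
    have T: "submodule (L' \<inter> hpart ?S 0) ?B ?D" (is "submodule ?T _ _")
      by (rule S.submodule_part[OF R0 sL'])
    have WT: "W \<subseteq> ?T"
    proof
      fix w assume w: "w \<in> W"
      then have "w \<in> hpart ?S 0"
        using P.submodule_mem[OF W(1)] by simp
      then have "w \<in> ?L"
        using w S.MG.part_closed[of w 0] S.MG.component_homogeneous[of w 0 0] by simp
      then show "w \<in> ?T"
        using L'(2) \<open>w \<in> hpart ?S 0\<close> by blast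
    qed
    show "L' = ?L \<or> L' = carrier A"
    \<comment> \<open>The degree zero part of \<open>L'\<close> decides. Inside \<open>W\<close>, it
      forces \<open>L' = ?L\<close>. Otherwise, subtracting an element of \<open>W\<close> leaves a
      nonzero element of the simple complement \<open>?Y\<close>; then \<open>?T\<close> contains
      \<open>W\<close> and \<open>?Y\<close>, hence \<open>1\<close>.\<close>
    proof (cases "?T \<subseteq> W")
      case True
      have "x \<in> ?L" if "x \<in> L'" for x
        using S.graded_submodule_component_lowest[OF R0 low L'(1) that] True
          S.MG.component_part[of x 0] S.submodule_mem[OF sL' that] by blast
      then show ?thesis
        using L'(2) by blast
    next
      case False
      then obtain t where t: "t \<in> ?T" "t \<notin> W"
        by blast
      then have "t \<in> W <+>\<^bsub>?D\<^esub> ?Y"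
        using WY by simp
      then obtain w s where ws: "w \<in> W" "s \<in> ?Y" "t = w \<oplus>\<^bsub>?D\<^esub> s"
        unfolding set_add_def' by blast
      have wD: "w \<in> carrier ?D" and sD: "s \<in> carrier ?D"
        using P.submodule_mem[OF W(1) ws(1)] P.submodule_mem[OF Y ws(2)] by auto
      have "s = (\<ominus>\<^bsub>?D\<^esub> w) \<oplus>\<^bsub>?D\<^esub> t"
        unfolding ws(3) using P.M.r_neg1[OF wD sD] by simp
      then have "s \<in> ?T"
        using P.submodule_add[OF T P.submodule_minus[OF T] t(1)] WT ws(1) by blast
      moreover have "s \<noteq> \<zero>\<^bsub>?D\<^esub>"
        using t(2) ws P.M.r_zero[OF wD] by auto
      moreover have "submodule (?T \<inter> ?Y) ?B ?D"
        by (rule P.submodule_Int[OF T Y])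
      ultimately have "y \<in> ?T \<inter> ?Y"
        using simple ws(2) by blast
      then have YT: "?Y \<subseteq> ?T"
        using P.submodule_smult[OF T] by blast
      have "u \<in> ?T" if "u \<in> carrier ?D" for u
      proof -
        have "u \<in> W <+>\<^bsub>?D\<^esub> ?Y"
          using that WY by simp
        then show ?thesis
          using WT YT P.submodule_add[OF T] unfolding set_add_def' by blast
      qed
      then have "\<one>\<^bsub>A\<^esub> \<in> L'"
        using one_part part0 by auto
      then have "x \<in> L'" if "x \<in> carrier A" for x
        using S.submodule_smult[OF sL' that, of "\<one>\<^bsub>A\<^esub>"] that by (simp add: S)
      then show ?thesis
        using S.submodule_carrier[OF sL'] car by blast
    qed
  qed
  then have "a \<in> ?L"
    using a unfolding graded_jacobson_radical_def by blast
  then show False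
    using W(2) comp[OF ac] by simp
qed


section \<open>Summands of graded projective modules\<close>

text \<open>The \<open>A\<^sub>0\<close>-module \<open>Y\<close> placed in degree \<open>j\<close>,
  with all scalars of positive degree acting as zero. The scalar action of \<open>M\<close> is
  replaced because it can lead out of \<open>Y\<close>.\<close>

definition concentrated ::
    "('a, 'c) ring_scheme \<Rightarrow> (nat \<Rightarrow> 'a set) \<Rightarrow> ('a, 'm) gmodule \<Rightarrow> int \<Rightarrow> 'm set \<Rightarrow> ('a, 'm) gmodule" where
  "concentrated A G M j Y = M\<lparr>carrier := Y, smult := (\<lambda>a x. component A G 0 a \<odot>\<^bsub>M\<^esub> x),
     hpart := (\<lambda>i. if i = j then Y else {\<zero>\<^bsub>M\<^esub>})\<rparr>"

context graded_module
begin

lemma concentrated_graded_module: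
  assumes R0: "ring (A\<lparr>carrier := G 0\<rparr>)"
    and Y: "submodule Y (A\<lparr>carrier := G 0\<rparr>) (M\<lparr>carrier := hpart M j\<rparr>)"
  shows "graded_module A G (concentrated A G M j Y)" (is "graded_module A G ?N")
proof -
  note N = concentrated_def
  interpret P: left_module "A\<lparr>carrier := G 0\<rparr>" "M\<lparr>carrier := hpart M j\<rparr>"
    by (rule left_module_part[OF R0])
  have Yc: "x \<in> carrier M" if "x \<in> Y" for x
    using P.submodule_mem[OF Y that] MG.part_closed by simp
  have Ya: "x \<oplus>\<^bsub>M\<^esub> y \<in> Y" if "x \<in> Y" "y \<in> Y" for x y
    using P.submodule_add[OF Y that] by simp
  have Yz: "\<zero>\<^bsub>M\<^esub> \<in> Y"
    using P.submodule_zero[OF Y] by simp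
  have Ys: "a \<odot>\<^bsub>M\<^esub> x \<in> Y" if "a \<in> G 0" "x \<in> Y" for a x
    using P.submodule_smult[OF Y, of a x] that by simp
  have c0: "RG.comp 0 a \<in> G 0" "RG.comp 0 a \<in> carrier A" if "a \<in> carrier A" for a
    using that RG.component_part RG.component_closed by auto
  have "abelian_group ?N"
  proof (rule abelian_groupI)
    show "\<exists>y\<in>carrier ?N. y \<oplus>\<^bsub>?N\<^esub> x = \<zero>\<^bsub>?N\<^esub>" if "x \<in> carrier ?N" for x
    proof -
      let ?m = "\<ominus>\<^bsub>M\<lparr>carrier := hpart M j\<rparr>\<^esub> x"
      have "x \<in> Y"
        using that by (simp add: N)
      then have "?m \<in> Y" "?m \<oplus>\<^bsub>M\<^esub> x = \<zero>\<^bsub>M\<^esub>"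
        using P.submodule_minus[OF Y] P.M.l_neg[OF P.submodule_mem[OF Y]] by simp_all
      then show ?thesis
        by (intro bexI[of _ ?m]) (simp_all add: N)
    qed
  qed (auto simp: N Yc Ya Yz M.a_ac)
  then interpret N: left_module A ?N
    by (intro left_module.intro left_module_axioms.intro ring_axioms)
      (auto simp: N Yc Ys c0 lm_smult_l_distr lm_smult_r_distr lm_smult_assoc lm_smult_one
        RG.component_add component_zero_mult RG.component_homogeneous[OF one_part])
  have sub0: "submodule Y A ?N"
    by (rule N.submodule_intro) (simp_all add: N Ya Yz Ys c0)
  have sub1: "submodule {\<zero>\<^bsub>M\<^esub>} A ?N"
    by (rule N.submodule_intro) (simp_all add: N Yz c0 smult_zero_right)
  have "decomposes ?N (hpart ?N)"
  proof (rule N.M.decomposesI[where \<pi> = "\<lambda>i x. if i = j then x else \<zero>\<^bsub>M\<^esub>"])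
    show "additive_subgroup (hpart ?N i) ?N" for i
      using sub0 sub1 by (auto simp: N submodule_def intro: additive_subgroupI)
    show "\<exists>I. finite I \<and> (\<forall>i. i \<notin> I \<longrightarrow> (if i = j then x else \<zero>\<^bsub>M\<^esub>) = \<zero>\<^bsub>?N\<^esub>) \<and>
        x = (\<Oplus>\<^bsub>?N\<^esub>i\<in>I. if i = j then x else \<zero>\<^bsub>M\<^esub>)" if "x \<in> carrier ?N" for x
    proof (intro exI[of _ "{j}"] conjI)
      have "(\<Oplus>\<^bsub>?N\<^esub>i\<in>{j}. if i = j then x else \<zero>\<^bsub>M\<^esub>) = x \<oplus>\<^bsub>?N\<^esub> (\<Oplus>\<^bsub>?N\<^esub>i\<in>{}. if i = j then x else \<zero>\<^bsub>M\<^esub>)"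
        using that by (subst N.M.finsum_insert) auto
      also have "\<dots> = x"
        using that by (subst N.M.finsum_empty) simp
      finally show "x = (\<Oplus>\<^bsub>?N\<^esub>i\<in>{j}. if i = j then x else \<zero>\<^bsub>M\<^esub>)"
        by simp
    qed (simp_all add: N)
  qed (auto simp: N Yz Yc split: if_splits)
  moreover have "a \<odot>\<^bsub>?N\<^esub> x \<in> hpart ?N (int i + k)" if a: "a \<in> G i" and x: "x \<in> hpart ?N k" for a i x k
  proof -
    have ac: "a \<in> carrier A"
      using RG.part_closed[OF a] .
    show ?thesis
    proof (cases "i = 0 \<and> k = j")
      case True
      then show ?thesis
        using x Ys c0[OF ac] by (simp add: N)
    next
      case False
      then have "a \<odot>\<^bsub>?N\<^esub> x = \<zero>\<^bsub>M\<^esub>"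
        using x ac c0[OF ac] Yc RG.component_homogeneous[OF a, of 0]
        by (auto simp: N smult_zero_left smult_zero_right split: if_splits)
      then show ?thesis
        using Yz by (simp add: N)
    qed
  qed
  ultimately show ?thesis
    by (intro graded_module.intro graded_left_module.intro graded_left_module_axioms.intro
        graded_ring_axioms N.left_module_axioms)
qed

lemma gr_hom_component:
  assumes N: "graded_module A G N" and f: "f \<in> gr_hom A M N" and x: "x \<in> carrier M"
  shows "component N (hpart N) i (f x) = f (MG.comp i x)"
  using x
proof (rule MG.graded_induct)
  interpret N: graded_module A G N
    by (rule N)
  have fc: "f x \<in> carrier N" if "x \<in> carrier M" for x
    using f that by (auto simp: gr_hom_def)
  have add: "f (x \<oplus>\<^bsub>M\<^esub> y) = f x \<oplus>\<^bsub>N\<^esub> f y" if "x \<in> carrier M" "y \<in> carrier M" for x y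
    using f that by (auto simp: gr_hom_def)
  have f0: "f \<zero>\<^bsub>M\<^esub> = \<zero>\<^bsub>N\<^esub>"
    using add[of "\<zero>\<^bsub>M\<^esub>" "\<zero>\<^bsub>M\<^esub>"] fc[of "\<zero>\<^bsub>M\<^esub>"] by simp
  show "component N (hpart N) i (f \<zero>\<^bsub>M\<^esub>) = f (MG.comp i \<zero>\<^bsub>M\<^esub>)"
    by (simp add: f0 N.MG.component_zero MG.component_zero)
  show "component N (hpart N) i (f x) = f (MG.comp i x)" if "x \<in> hpart M k" for k x
  proof -
    have "f x \<in> hpart N k"
      using f that unfolding gr_hom_def by blast
    then show ?thesis
      using that by (simp add: N.MG.component_homogeneous MG.component_homogeneous f0)
  qed
  show "component N (hpart N) i (f (x \<oplus>\<^bsub>M\<^esub> y)) = f (MG.comp i (x \<oplus>\<^bsub>M\<^esub> y))"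
    if "x \<in> carrier M" "y \<in> carrier M" "component N (hpart N) i (f x) = f (MG.comp i x)"
      "component N (hpart N) i (f y) = f (MG.comp i y)" for x y
    using that by (simp add: add fc N.MG.component_add MG.component_add MG.component_closed)
qed

text \<open>The complement is the kernel, through the splitting of \<open>x\<close> into
  \<open>\<theta> x\<close> and \<open>x - \<theta> x\<close>. Both pieces are graded since
  \<open>\<theta>\<close> commutes with components.\<close>

lemma idempotent_direct_summand:
  assumes \<theta>: "\<theta> \<in> gr_hom A M M" and idem: "\<And>x. x \<in> carrier M \<Longrightarrow> \<theta> (\<theta> x) = \<theta> x"
  shows "direct_summand A M (\<theta> ` carrier M)"
proof -
  have c: "\<theta> x \<in> carrier M" if "x \<in> carrier M" for x
    using \<theta> that by (auto simp: gr_hom_def)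
  have add: "\<theta> (x \<oplus>\<^bsub>M\<^esub> y) = \<theta> x \<oplus>\<^bsub>M\<^esub> \<theta> y" if "x \<in> carrier M" "y \<in> carrier M" for x y
    using \<theta> that by (auto simp: gr_hom_def)
  have smult: "\<theta> (a \<odot>\<^bsub>M\<^esub> x) = a \<odot>\<^bsub>M\<^esub> \<theta> x" if "a \<in> carrier A" "x \<in> carrier M" for a x
    using \<theta> that by (auto simp: gr_hom_def)
  have zero: "\<theta> \<zero>\<^bsub>M\<^esub> = \<zero>\<^bsub>M\<^esub>"
    using add[of "\<zero>\<^bsub>M\<^esub>" "\<zero>\<^bsub>M\<^esub>"] c[of "\<zero>\<^bsub>M\<^esub>"] by simp
  have comp: "MG.comp i (\<theta> x) = \<theta> (MG.comp i x)" if "x \<in> carrier M" for x i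
    by (rule gr_hom_component[OF graded_module_axioms \<theta> that])
  have minus: "\<theta> (\<ominus>\<^bsub>M\<^esub> x) = \<ominus>\<^bsub>M\<^esub> (\<theta> x)" if "x \<in> carrier M" for x
    using that add[of "\<ominus>\<^bsub>M\<^esub> x" x] c zero
    by (intro M.minus_equality[symmetric]) (auto simp: M.l_neg)
  let ?I = "\<theta> ` carrier M" and ?K = "{x \<in> carrier M. \<theta> x = \<zero>\<^bsub>M\<^esub>}"
  have I: "graded_submodule A M ?I"
  proof (rule graded_submoduleI)
    show "submodule ?I A M"
    proof (rule submodule_intro)
      show "\<zero>\<^bsub>M\<^esub> \<in> ?I"
        using zero by (metis M.zero_closed imageI)
      show "x \<oplus>\<^bsub>M\<^esub> y \<in> ?I" if "x \<in> ?I" "y \<in> ?I" for x y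
        using that add[symmetric] by auto
      show "a \<odot>\<^bsub>M\<^esub> x \<in> ?I" if "a \<in> carrier A" "x \<in> ?I" for a x
        using that smult[symmetric] lm_smult_closed by auto
    qed (use c in auto)
    show "MG.comp i x \<in> ?I" if "x \<in> ?I" for x i
      using that comp MG.component_closed by auto
  qed
  have K: "graded_submodule A M ?K"
  proof (rule graded_submoduleI)
    show "submodule ?K A M"
      by (rule submodule_intro) (auto simp: zero add smult lm_smult_closed smult_zero_right)
    show "MG.comp i x \<in> ?K" if "x \<in> ?K" for x i
      using that comp[of x i] MG.component_closed MG.component_zero by auto
  qed
  have "x \<in> ?I <+>\<^bsub>M\<^esub> ?K" if x: "x \<in> carrier M" for x
  proof -
    have "\<theta> x \<oplus>\<^bsub>M\<^esub> (\<ominus>\<^bsub>M\<^esub> \<theta> x \<oplus>\<^bsub>M\<^esub> x) = x"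
      using c[OF x] x by (simp add: M.r_neg2)
    moreover have "\<ominus>\<^bsub>M\<^esub> \<theta> x \<oplus>\<^bsub>M\<^esub> x \<in> ?K"
      using c[OF x] x by (simp add: add minus idem M.l_neg)
    ultimately show ?thesis
      using x unfolding set_add_def' by (metis (no_types, lifting) UN_I imageI insertI1)
  qed
  moreover have "?I <+>\<^bsub>M\<^esub> ?K \<subseteq> carrier M"
    using c by (auto simp: set_add_def')
  moreover have "?I \<inter> ?K = {\<zero>\<^bsub>M\<^esub>}"
    using idem zero by force
  ultimately show ?thesis
    unfolding direct_summand_def direct_sum_of_def using I K by blast
qed

text \<open>Lifting the projection \<open>M \<rightarrow> M\<^sub>j \<rightarrow> A\<^sub>0 y\<close> along \<open>A(-j) \<rightarrow> A\<^sub>0 y\<close>, \<open>a \<mapsto> a\<^sub>0 y\<close>, to \<open>h\<close>, the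
  endomorphism \<open>x \<mapsto> h x \<cdot> y\<close> is an idempotent with image \<open>A y\<close>.\<close>

lemma projective_lowest_summand:
  fixes j :: int
  assumes ss: "semisimple_ring (A\<lparr>carrier := G 0\<rparr>)" and proj: "graded_projective A G M"
    and low: "\<And>i. i < j \<Longrightarrow> hpart M i = {\<zero>\<^bsub>M\<^esub>}" and nz: "hpart M j \<noteq> {\<zero>\<^bsub>M\<^esub>}"
  obtains y where "y \<in> hpart M j" "direct_summand A M (gen_submodule A M {y})"
    "indecomposable A M (gen_submodule A M {y})"
proof -
  let ?B = "A\<lparr>carrier := G 0\<rparr>" and ?D = "M\<lparr>carrier := hpart M j\<rparr>"
  have R0: "ring ?B"
    using ss by (simp add: semisimple_ring_def)
  interpret P: left_module ?B ?D
    by (rule left_module_part[OF R0])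
  obtain z where "z \<in> carrier ?D" "z \<noteq> \<zero>\<^bsub>?D\<^esub>"
    using nz MG.part_zero by auto
  then obtain W y where W: "submodule W ?B ?D" "z \<notin> W" "y \<in> carrier ?D" "y \<notin> W"
    and WY: "W <+>\<^bsub>?D\<^esub> (\<lambda>a. a \<odot>\<^bsub>?D\<^esub> y) ` carrier ?B = carrier ?D"
      "W \<inter> (\<lambda>a. a \<odot>\<^bsub>?D\<^esub> y) ` carrier ?B = {\<zero>\<^bsub>?D\<^esub>}"
    and simple: "\<forall>T. submodule T ?B ?D \<longrightarrow> T \<subseteq> (\<lambda>a. a \<odot>\<^bsub>?D\<^esub> y) ` carrier ?B \<longrightarrow> T \<noteq> {\<zero>\<^bsub>?D\<^esub>} \<longrightarrow> y \<in> T"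
    by (rule P.semisimple_simple_summand[OF ss])
  define Y where "Y = (\<lambda>a. a \<odot>\<^bsub>M\<^esub> y) ` G 0"
  have Y_eq: "(\<lambda>a. a \<odot>\<^bsub>?D\<^esub> y) ` carrier ?B = Y"
    by (simp add: Y_def)
  have WY_sum: "W <+>\<^bsub>?D\<^esub> Y = hpart M j" and WY_int: "W \<inter> Y = {\<zero>\<^bsub>M\<^esub>}"
    using WY unfolding Y_eq by simp_all
  have Y_simple: "y \<in> T" if "submodule T ?B ?D" "T \<subseteq> Y" "T \<noteq> {\<zero>\<^bsub>M\<^esub>}" for T
    using simple that unfolding Y_eq by simp
  have yj: "y \<in> hpart M j"
    using W(3) by simp
  have yM: "y \<in> carrier M"
    using MG.part_closed[OF yj] .
  have y_nz: "y \<noteq> \<zero>\<^bsub>M\<^esub>"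
    using W(4) P.submodule_zero[OF W(1)] by auto
  have Y: "submodule Y ?B ?D"
    using P.submodule_cyclic[OF W(3)] unfolding Y_eq .
  have yY: "y \<in> Y"
    using lm_smult_one[OF yM] one_part by (force simp: Y_def)
  have Yj: "Y \<subseteq> hpart M j" and Wj: "W \<subseteq> hpart M j"
    using P.submodule_carrier[OF Y] P.submodule_carrier[OF W(1)] by simp_all
  have YM: "s \<in> carrier M" if "s \<in> Y" for s
    using that Yj MG.part_closed by blast
  have WM: "w \<in> carrier M" if "w \<in> W" for w
    using that Wj MG.part_closed by blast
  let ?N = "concentrated A G M j Y"
  let ?S = "shifted_regular A G (\<lambda>a (_::nat). a) (\<lambda>f. f 0) j"
  interpret N: graded_module A G ?N
    by (rule concentrated_graded_module[OF R0 Y])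
  interpret S: graded_module A G ?S
    by (rule shifted_regular_graded_module) simp
  have c0: "RG.comp 0 a \<in> G 0" "RG.comp 0 a \<in> carrier A" if "a \<in> carrier A" for a
    using that RG.component_part RG.component_closed by auto

  \<comment> \<open>The target of the lifting problem: \<open>Y\<close> concentrated in degree
    \<open>j\<close>\<close>
  have N_gen: "carrier ?N = gen_submodule A ?N {y}"
  proof -
    have "gen_submodule A ?N {y} = (\<lambda>a. RG.comp 0 a \<odot>\<^bsub>M\<^esub> y) ` carrier A"
      using N.gen_submodule_singleton[of y] yY by (simp add: concentrated_def)
    also have "\<dots> = Y"
    proof
      show "(\<lambda>a. RG.comp 0 a \<odot>\<^bsub>M\<^esub> y) ` carrier A \<subseteq> Y"
        using c0 by (auto simp: Y_def)
      show "Y \<subseteq> (\<lambda>a. RG.comp 0 a \<odot>\<^bsub>M\<^esub> y) ` carrier A"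
      proof
        fix s assume "s \<in> Y"
        then obtain a where a: "a \<in> G 0" "s = a \<odot>\<^bsub>M\<^esub> y"
          by (auto simp: Y_def)
        then have "s = RG.comp 0 a \<odot>\<^bsub>M\<^esub> y"
          using RG.component_homogeneous[OF a(1), of 0] by simp
        then show "s \<in> (\<lambda>a. RG.comp 0 a \<odot>\<^bsub>M\<^esub> y) ` carrier A"
          using RG.part_closed[OF a(1)] by blast
      qed
    qed
    finally show ?thesis
      by (simp add: concentrated_def)
  qed
  have N_obj: "gr_object A G ?N"
    unfolding gr_object_def fin_gen_def
    using N.graded_left_module_axioms N_gen yY
    by (intro conjI exI[of _ "{y}"]) (auto simp: concentrated_def)
  have S_obj: "gr_object A G ?S"
    unfolding gr_object_def using S.graded_left_module_axioms shifted_regular_fin_gen[of "\<lambda>f. f 0" "\<lambda>a _. a" j]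
    by simp

  \<comment> \<open>The epimorphism from the shifted regular module onto \<open>Y\<close>\<close>
  let ?g = "\<lambda>f::nat \<Rightarrow> 'a. RG.comp 0 (f 0) \<odot>\<^bsub>M\<^esub> y"
  have S_zero: "f 0 \<in> carrier A" if "f \<in> carrier ?S" for f
    using that by (auto simp: shifted_regular_def)
  have S_add: "(u \<oplus>\<^bsub>?S\<^esub> v) 0 = u 0 \<oplus>\<^bsub>A\<^esub> v 0" and S_smult: "(a \<odot>\<^bsub>?S\<^esub> u) 0 = a \<otimes>\<^bsub>A\<^esub> u 0" for a u v
    by (simp_all add: shifted_regular_def)
  have N_add: "u \<oplus>\<^bsub>?N\<^esub> v = u \<oplus>\<^bsub>M\<^esub> v" and N_smult: "a \<odot>\<^bsub>?N\<^esub> u = RG.comp 0 a \<odot>\<^bsub>M\<^esub> u" for a u v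
    by (simp_all add: concentrated_def)
  have gY: "?g f \<in> Y" if "f \<in> carrier ?S" for f
    using that c0 by (auto simp: shifted_regular_def Y_def)
  have g: "?g \<in> gr_hom A ?S ?N"
    unfolding gr_hom_def
  proof (intro CollectI conjI ballI allI)
    show "?g \<in> carrier ?S \<rightarrow> carrier ?N"
      using gY by (auto simp: concentrated_def)
    show "?g (u \<oplus>\<^bsub>?S\<^esub> v) = ?g u \<oplus>\<^bsub>?N\<^esub> ?g v" if "u \<in> carrier ?S" "v \<in> carrier ?S" for u v
      using lm_smult_l_distr[OF c0(2)[OF S_zero[OF that(1)]] c0(2)[OF S_zero[OF that(2)]] yM]
        RG.component_add[OF S_zero[OF that(1)] S_zero[OF that(2)]]
      by (simp add: S_add N_add)
    show "?g (a \<odot>\<^bsub>?S\<^esub> u) = a \<odot>\<^bsub>?N\<^esub> ?g u" if "a \<in> carrier A" "u \<in> carrier ?S" for a u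
      using lm_smult_assoc[OF c0(2)[OF that(1)] c0(2)[OF S_zero[OF that(2)]] yM]
        component_zero_mult[OF that(1) S_zero[OF that(2)]]
      by (simp add: S_smult N_smult)
    show "?g ` hpart ?S i \<subseteq> hpart ?N i" for i
    proof
      fix s assume "s \<in> ?g ` hpart ?S i"
      then obtain a where a: "s = RG.comp 0 a \<odot>\<^bsub>M\<^esub> y" "a \<in> (if j \<le> i then G (nat (i - j)) else {\<zero>\<^bsub>A\<^esub>})"
        by (auto simp: shifted_regular_def)
      show "s \<in> hpart ?N i"
      proof (cases "i = j")
        case True
        then show ?thesis
          using a c0 RG.part_closed by (auto simp: concentrated_def Y_def)
      next
        case False
        then have "RG.comp 0 a = \<zero>\<^bsub>A\<^esub>"
          using a(2) by (auto simp: RG.component_homogeneous RG.component_zero split: if_splits)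
        then show ?thesis
          using False a(1) yM by (simp add: concentrated_def smult_zero_left)
      qed
    qed
  qed
  have g_surj: "?g ` carrier ?S = carrier ?N"
  proof
    show "?g ` carrier ?S \<subseteq> carrier ?N"
      using gY by (auto simp: concentrated_def)
    show "carrier ?N \<subseteq> ?g ` carrier ?S"
    proof
      fix s assume "s \<in> carrier ?N"
      then obtain a where a: "a \<in> G 0" "s = a \<odot>\<^bsub>M\<^esub> y"
        by (auto simp: concentrated_def Y_def)
      then have "s = ?g (\<lambda>_. a)" "(\<lambda>_. a) \<in> carrier ?S"
        using RG.component_homogeneous[OF a(1), of 0] RG.part_closed[OF a(1)]
        by (simp_all add: shifted_regular_def)
      then show "s \<in> ?g ` carrier ?S"
        by (rule image_eqI[of _ ?g])
    qed
  qed

  \<comment> \<open>The projection \<open>q\<close> of \<open>M\<close> onto \<open>Y\<close> along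
    \<open>W\<close> and the higher degrees\<close>
  define q where "q x = (THE s. s \<in> Y \<and> (\<exists>w\<in>W. MG.comp j x = w \<oplus>\<^bsub>M\<^esub> s))" for x
  have q_eq: "q x = s" if s: "s \<in> Y" "w \<in> W" "MG.comp j x = w \<oplus>\<^bsub>M\<^esub> s" for x s w
    unfolding q_def
  proof (rule the_equality)
    fix s' assume "s' \<in> Y \<and> (\<exists>w\<in>W. MG.comp j x = w \<oplus>\<^bsub>M\<^esub> s')"
    then obtain w' where w': "s' \<in> Y" "w' \<in> W" "w \<oplus>\<^bsub>M\<^esub> s = w' \<oplus>\<^bsub>M\<^esub> s'"
      using s(3) by auto
    have c: "w \<in> carrier M" "w' \<in> carrier M" "s \<in> carrier M" "s' \<in> carrier M"
      using that w' YM WM by auto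
    \<comment> \<open>Negatives are formed in the restricted record, since the closure facts for
      \<open>W\<close> and \<open>Y\<close> speak of that record; addition and zero are those of
      \<open>M\<close>.\<close>
    let ?m = "a_inv ?D"
    have mw: "?m w' \<in> W" "?m w' \<oplus>\<^bsub>M\<^esub> w' = \<zero>\<^bsub>M\<^esub>"
      using P.submodule_minus[OF W(1) w'(2)] P.M.l_neg[OF P.submodule_mem[OF W(1) w'(2)]] by simp_all
    have ms: "?m s \<in> Y" "s \<oplus>\<^bsub>M\<^esub> ?m s = \<zero>\<^bsub>M\<^esub>"
      using P.submodule_minus[OF Y that(1)] P.M.r_neg[OF P.submodule_mem[OF Y that(1)]] by simp_all
    have cm: "?m w' \<in> carrier M" "?m s \<in> carrier M"
      using mw(1) ms(1) YM WM by auto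
    have "?m w' \<oplus>\<^bsub>M\<^esub> w = ?m w' \<oplus>\<^bsub>M\<^esub> (w \<oplus>\<^bsub>M\<^esub> s) \<oplus>\<^bsub>M\<^esub> ?m s"
      using c cm ms(2) by (simp add: M.a_assoc)
    also have "\<dots> = (?m w' \<oplus>\<^bsub>M\<^esub> w') \<oplus>\<^bsub>M\<^esub> (s' \<oplus>\<^bsub>M\<^esub> ?m s)"
      unfolding w'(3) using c cm by (simp add: M.a_assoc)
    finally have eq: "?m w' \<oplus>\<^bsub>M\<^esub> w = s' \<oplus>\<^bsub>M\<^esub> ?m s"
      using c cm mw(2) by simp
    have "?m w' \<oplus>\<^bsub>M\<^esub> w \<in> W"
      using P.submodule_add[OF W(1) mw(1) that(2)] by simp
    moreover have "s' \<oplus>\<^bsub>M\<^esub> ?m s \<in> Y"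
      using P.submodule_add[OF Y w'(1) ms(1)] by simp
    ultimately have z: "s' \<oplus>\<^bsub>M\<^esub> ?m s = \<zero>\<^bsub>M\<^esub>"
      using WY_int eq by auto
    have "s' = s' \<oplus>\<^bsub>M\<^esub> (?m s \<oplus>\<^bsub>M\<^esub> s)"
      using c cm ms(2) by (simp add: M.a_comm)
    also have "\<dots> = s"
      using c cm z by (simp add: M.a_assoc[symmetric])
    finally show "s' = s" .
  qed (use that in blast)
  have q_ex: "\<exists>w\<in>W. q x \<in> Y \<and> MG.comp j x = w \<oplus>\<^bsub>M\<^esub> q x" if x: "x \<in> carrier M" for x
  proof -
    have "MG.comp j x \<in> W <+>\<^bsub>?D\<^esub> Y"
      using WY_sum MG.component_part[OF x, of j] by simp
    then obtain w s where "w \<in> W" "s \<in> Y" "MG.comp j x = w \<oplus>\<^bsub>M\<^esub> s"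
      by (auto simp: set_add_def')
    then show ?thesis
      using q_eq by metis
  qed
  have q: "q \<in> gr_hom A M ?N"
    unfolding gr_hom_def
  proof (intro CollectI conjI ballI allI)
    show "q \<in> carrier M \<rightarrow> carrier ?N"
      using q_ex by (auto simp: concentrated_def)
    show "q (x \<oplus>\<^bsub>M\<^esub> x') = q x \<oplus>\<^bsub>?N\<^esub> q x'" if x: "x \<in> carrier M" "x' \<in> carrier M" for x x'
    proof -
      obtain w where w: "w \<in> W" "q x \<in> Y" "MG.comp j x = w \<oplus>\<^bsub>M\<^esub> q x"
        using q_ex[OF x(1)] by blast
      obtain w' where w': "w' \<in> W" "q x' \<in> Y" "MG.comp j x' = w' \<oplus>\<^bsub>M\<^esub> q x'"
        using q_ex[OF x(2)] by blast
      have "q (x \<oplus>\<^bsub>M\<^esub> x') = q x \<oplus>\<^bsub>M\<^esub> q x'"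
      proof (rule q_eq)
        show "q x \<oplus>\<^bsub>M\<^esub> q x' \<in> Y" "w \<oplus>\<^bsub>M\<^esub> w' \<in> W"
          using P.submodule_add[OF Y w(2) w'(2)] P.submodule_add[OF W(1) w(1) w'(1)] by simp_all
        show "MG.comp j (x \<oplus>\<^bsub>M\<^esub> x') = (w \<oplus>\<^bsub>M\<^esub> w') \<oplus>\<^bsub>M\<^esub> (q x \<oplus>\<^bsub>M\<^esub> q x')"
          unfolding MG.component_add[OF x] w(3) w'(3)
          using w(1,2) w'(1,2) YM WM by (simp add: M.a_ac)
      qed
      then show ?thesis
        by (simp add: concentrated_def)
    qed
    show "q (a \<odot>\<^bsub>M\<^esub> x) = a \<odot>\<^bsub>?N\<^esub> q x" if a: "a \<in> carrier A" and x: "x \<in> carrier M" for a x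
    proof -
      obtain w where w: "w \<in> W" "q x \<in> Y" "MG.comp j x = w \<oplus>\<^bsub>M\<^esub> q x"
        using q_ex[OF x] by blast
      have "q (a \<odot>\<^bsub>M\<^esub> x) = RG.comp 0 a \<odot>\<^bsub>M\<^esub> q x"
      proof (rule q_eq)
        show "RG.comp 0 a \<odot>\<^bsub>M\<^esub> q x \<in> Y" "RG.comp 0 a \<odot>\<^bsub>M\<^esub> w \<in> W"
          using P.submodule_smult[OF Y _ w(2), of "RG.comp 0 a"]
            P.submodule_smult[OF W(1) _ w(1), of "RG.comp 0 a"] c0[OF a] by simp_all
        show "MG.comp j (a \<odot>\<^bsub>M\<^esub> x) = RG.comp 0 a \<odot>\<^bsub>M\<^esub> w \<oplus>\<^bsub>M\<^esub> RG.comp 0 a \<odot>\<^bsub>M\<^esub> q x"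
          using component_smult_lowest[OF low a x] w YM WM c0[OF a] by (simp add: lm_smult_r_distr)
      qed
      then show ?thesis
        by (simp add: concentrated_def)
    qed
    show "q ` hpart M i \<subseteq> hpart ?N i" for i
    proof
      fix s assume "s \<in> q ` hpart M i"
      then obtain x where x: "x \<in> hpart M i" "s = q x"
        by blast
      have xM: "x \<in> carrier M"
        using MG.part_closed[OF x(1)] .
      show "s \<in> hpart ?N i"
      proof (cases "i = j")
        case True
        then show ?thesis
          using q_ex[OF xM] x(2) by (auto simp: concentrated_def)
      next
        case False
        then have "q x = \<zero>\<^bsub>M\<^esub>"
          using MG.component_homogeneous[OF x(1), of j] P.submodule_zero[OF Y] P.submodule_zero[OF W(1)]
          by (intro q_eq[of _ "\<zero>\<^bsub>M\<^esub>"]) simp_all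
        then show ?thesis
          using False x(2) by (simp add: concentrated_def)
      qed
    qed
  qed
  have qy: "q y = y"
    using MG.component_homogeneous[OF yj, of j] P.submodule_zero[OF W(1)] yY yM
    by (intro q_eq[of _ "\<zero>\<^bsub>M\<^esub>"]) simp_all

  \<comment> \<open>The lift \<open>h\<close> and the idempotent endomorphism with image
    \<open>A y\<close>\<close>
  obtain h where h: "h \<in> gr_hom A M ?S" "\<And>x. x \<in> carrier M \<Longrightarrow> ?g (h x) = q x"
    using proj S_obj N_obj g g_surj q unfolding graded_projective_def by blast
  have hS: "h x \<in> carrier ?S" if "x \<in> carrier M" for x
    using h(1) that by (auto simp: gr_hom_def)
  then have hA: "h x 0 \<in> carrier A" if "x \<in> carrier M" for x
    using that by (fastforce simp: shifted_regular_def)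
  have h_add: "h (x \<oplus>\<^bsub>M\<^esub> x') 0 = h x 0 \<oplus>\<^bsub>A\<^esub> h x' 0" if "x \<in> carrier M" "x' \<in> carrier M" for x x'
    using h(1) that by (auto simp: gr_hom_def shifted_regular_def)
  have h_smult: "h (a \<odot>\<^bsub>M\<^esub> x) 0 = a \<otimes>\<^bsub>A\<^esub> h x 0" if "a \<in> carrier A" "x \<in> carrier M" for a x
    using h(1) that by (auto simp: gr_hom_def shifted_regular_def)
  have h_part: "h x 0 \<in> (if j \<le> i then G (nat (i - j)) else {\<zero>\<^bsub>A\<^esub>})" if "x \<in> hpart M i" for x i
  proof -
    have "h x \<in> hpart ?S i"
      using h(1) that unfolding gr_hom_def by blast
    then show ?thesis
      by (auto simp: shifted_regular_def)
  qed
  let ?\<theta> = "\<lambda>x. h x 0 \<odot>\<^bsub>M\<^esub> y"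
  have \<theta>: "?\<theta> \<in> gr_hom A M M"
    unfolding gr_hom_def
  proof (intro CollectI conjI ballI allI)
    show "?\<theta> ` hpart M i \<subseteq> hpart M i" for i
    proof
      fix u assume "u \<in> ?\<theta> ` hpart M i"
      then obtain x where x: "x \<in> hpart M i" "u = h x 0 \<odot>\<^bsub>M\<^esub> y"
        by blast
      show "u \<in> hpart M i"
      proof (cases "j \<le> i")
        case True
        then show ?thesis
          using h_part[OF x(1)] hpart_smult[OF _ yj, of "h x 0" "nat (i - j)"] x(2) by simp
      next
        case False
        then show ?thesis
          using h_part[OF x(1)] x(2) yM MG.part_zero by (simp add: smult_zero_left)
      qed
    qed
  qed (use hA h_add h_smult yM in \<open>auto simp: lm_smult_closed lm_smult_l_distr lm_smult_assoc\<close>)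
  \<comment> \<open>As \<open>y\<close> has degree \<open>j\<close>, the scalar \<open>h y 0\<close>
    lies in \<open>G 0\<close> and equals its own degree zero component. So \<open>h y 0\<close>
    times \<open>y\<close> is \<open>?g (h y) = q y = y\<close>.\<close>
  have \<theta>y: "?\<theta> y = y"
    using h_part[OF yj] h(2)[OF yM] qy RG.component_homogeneous[of "h y 0" 0 0] by simp
  have \<theta>_smult: "?\<theta> (a \<odot>\<^bsub>M\<^esub> y) = a \<odot>\<^bsub>M\<^esub> y" if "a \<in> carrier A" for a
    using that yM hA h_smult \<theta>y by (simp add: lm_smult_assoc)
  define Q where "Q = gen_submodule A M {y}"
  have Q: "Q = (\<lambda>a. a \<odot>\<^bsub>M\<^esub> y) ` carrier A"
    unfolding Q_def by (rule gen_submodule_singleton[OF yM])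
  have yQ: "y \<in> Q"
    unfolding Q_def using gen_submodule_superset[of "{y}"] yM by simp
  have "?\<theta> ` carrier M = Q"
  proof
    show "?\<theta> ` carrier M \<subseteq> Q"
      using hA by (auto simp: Q)
    show "Q \<subseteq> ?\<theta> ` carrier M"
    proof
      fix u assume "u \<in> Q"
      then obtain a where a: "a \<in> carrier A" "u = a \<odot>\<^bsub>M\<^esub> y"
        by (auto simp: Q)
      have "u = ?\<theta> u"
        using \<theta>_smult[OF a(1)] a(2) by simp
      moreover have "u \<in> carrier M"
        using a yM by (simp add: lm_smult_closed)
      ultimately show "u \<in> ?\<theta> ` carrier M"
        by blast
    qed
  qed
  \<comment> \<open>Idempotence holds because \<open>?\<theta>\<close> takes values in the multiples
    of \<open>y\<close> and, by linearity, fixes every such multiple.\<close>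
  then have summand: "direct_summand A M Q"
    using idempotent_direct_summand[OF \<theta>] \<theta>_smult hA by simp

  \<comment> \<open>Indecomposability of \<open>A y\<close> from simplicity of
    \<open>A\<^sub>0 y\<close>\<close>
  have Q_le: "Q \<subseteq> N'" if "submodule N' A M" "y \<in> N'" for N'
    unfolding Q_def by (rule gen_submodule_least) (use that in auto)
  have "indecomposable A M Q"
    unfolding indecomposable_def
  proof (intro conjI allI impI)
    show "graded_submodule A M Q"
      using summand by (simp add: direct_summand_def)
    show "Q \<noteq> {\<zero>\<^bsub>M\<^esub>}"
      using yQ y_nz by blast
    fix N1 N2 assume N12: "graded_submodule A M N1" "graded_submodule A M N2" "direct_sum_of M Q N1 N2"
    have s: "submodule N1 A M" "submodule N2 A M"
      using N12 by (auto simp: graded_submodule_def)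
    have sum: "N1 <+>\<^bsub>M\<^esub> N2 = Q" and int: "N1 \<inter> N2 = {\<zero>\<^bsub>M\<^esub>}"
      using N12(3) by (auto simp: direct_sum_of_def)
    have sub: "N1 \<subseteq> Q" "N2 \<subseteq> Q"
      using mem_sum_left[OF s] mem_sum_right[OF s] sum by blast+
    have QY: "x \<in> Y" if x: "x \<in> Q" "x \<in> hpart M j" for x
    proof -
      obtain a where a: "a \<in> carrier A" "x = a \<odot>\<^bsub>M\<^esub> y"
        using x(1) by (auto simp: Q)
      then have "x = RG.comp 0 a \<odot>\<^bsub>M\<^esub> y"
        using component_smult_lowest[OF low a(1) yM] MG.component_homogeneous[OF that(2), of j]
          MG.component_homogeneous[OF yj, of j] by simp
      then show ?thesis
        using c0[OF a(1)] by (auto simp: Y_def)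
    qed
    \<comment> \<open>The degree \<open>j\<close> part of \<open>Q\<close> is the simple module
      \<open>Y\<close>, so a submodule of \<open>Q\<close> with a nonzero element in degree
      \<open>j\<close> contains the generator.\<close>
    have full: "y \<in> N'" if "submodule N' A M" "N' \<subseteq> Q" "x \<in> N'" "x \<in> hpart M j" "x \<noteq> \<zero>\<^bsub>M\<^esub>" for N' x
    proof -
      have "submodule (N' \<inter> hpart M j) ?B ?D"
        by (rule submodule_part[OF R0 that(1)])
      moreover have "N' \<inter> hpart M j \<subseteq> Y"
        using that(2) QY by blast
      moreover have "N' \<inter> hpart M j \<noteq> {\<zero>\<^bsub>M\<^esub>}"
        using that by blast
      ultimately show ?thesis
        using Y_simple by blast
    qed
    obtain n1 n2 where n: "n1 \<in> N1" "n2 \<in> N2" "y = n1 \<oplus>\<^bsub>M\<^esub> n2"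
      using yQ sum unfolding set_add_def' by blast
    have nM: "n1 \<in> carrier M" "n2 \<in> carrier M"
      using n submodule_mem[OF s(1)] submodule_mem[OF s(2)] by auto
    \<comment> \<open>One summand has a nonzero \<open>j\<close>-th component, so it contains
      \<open>y\<close> and therefore all of \<open>Q\<close>; the other summand is then contained in
      the zero intersection.\<close>
    have "y = MG.comp j n1 \<oplus>\<^bsub>M\<^esub> MG.comp j n2"
      using MG.component_add[OF nM, of j] MG.component_homogeneous[OF yj, of j] n(3) by simp
    then have "MG.comp j n1 \<noteq> \<zero>\<^bsub>M\<^esub> \<or> MG.comp j n2 \<noteq> \<zero>\<^bsub>M\<^esub>"
      using y_nz by auto
    then have "y \<in> N1 \<or> y \<in> N2"
      using full[OF s(1) sub(1)] full[OF s(2) sub(2)] MG.component_part[OF nM(1)]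
        MG.component_part[OF nM(2)] graded_submodule_component_lowest[OF R0 low N12(1) n(1)]
        graded_submodule_component_lowest[OF R0 low N12(2) n(2)] by blast
    then show "N1 = {\<zero>\<^bsub>M\<^esub>} \<or> N2 = {\<zero>\<^bsub>M\<^esub>}"
      using Q_le[OF s(1)] Q_le[OF s(2)] sub int by blast
  qed
  then show ?thesis
    using that[OF yj] summand by (simp add: Q_def)
qed

end


lemma (in locally_finite_graded_algebra) graded_ring: "graded_ring A G"
  by unfold_locales (fact graded_decomposes graded_one graded_mult)+

text \<open>In the lowest degree a scalar acts through its degree zero component, and that component
  vanishes on the radical.\<close>

lemma (in graded_module) component_radical_times_lowest:
  assumes ss: "semisimple_ring (A\<lparr>carrier := G 0\<rparr>)"
    and low: "\<And>i. i < j \<Longrightarrow> hpart M i = {\<zero>\<^bsub>M\<^esub>}"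
    and x: "x \<in> ideal_times A (graded_jacobson_radical A G) M"
  shows "MG.comp j x = \<zero>\<^bsub>M\<^esub>"
proof -
  let ?K = "{x \<in> carrier M. MG.comp j x = \<zero>\<^bsub>M\<^esub>}"
  have "submodule ?K A M"
    by (rule submodule_intro)
      (auto simp: MG.component_zero MG.component_add component_smult_lowest[OF low] lm_smult_closed
        smult_zero_right RG.component_closed)
  moreover have "{a \<odot>\<^bsub>M\<^esub> x | a x. a \<in> graded_jacobson_radical A G \<and> x \<in> carrier M} \<subseteq> ?K"
    using component_zero_radical[OF ss] MG.component_closed
    by (auto simp: component_smult_lowest[OF low] lm_smult_closed smult_zero_left
        graded_jacobson_radical_def)
  ultimately show ?thesis
    using x gen_submodule_least unfolding ideal_times_def by blast
qed


section \<open>Complexes\<close>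

lemma inf_deg_le:
  "hpart (cohomology X i) j \<noteq> {\<zero>\<^bsub>cohomology X i\<^esub>} \<Longrightarrow> inf_deg X \<le> ereal (real_of_int (i + j))"
  unfolding inf_deg_def by (rule Inf_lower) blast

text \<open>Total degrees are integers: if \<open>d\<close> were not attained, \<open>d + 1\<close>
  would still be a lower bound.\<close>

lemma inf_deg_attained:
  assumes "inf_deg X = ereal (real_of_int d)"
  obtains i j where "i + j = d" "hpart (cohomology X i) j \<noteq> {\<zero>\<^bsub>cohomology X i\<^esub>}"
proof (rule ccontr)
  assume *: "\<not> thesis"
  have "ereal (real_of_int (d + 1)) \<le> inf_deg X"
    unfolding inf_deg_def
  proof (rule Inf_greatest)
    fix u assume "u \<in> {ereal (real_of_int (i + j)) | i j. hpart (cohomology X i) j \<noteq> {\<zero>\<^bsub>cohomology X i\<^esub>}}"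
    then obtain i j where u: "u = ereal (real_of_int (i + j))"
        and nz: "hpart (cohomology X i) j \<noteq> {\<zero>\<^bsub>cohomology X i\<^esub>}"
      by blast
    have "d \<le> i + j"
      using inf_deg_le[OF nz] assms by simp
    moreover have "i + j \<noteq> d"
      using * that nz by blast
    ultimately show "ereal (real_of_int (d + 1)) \<le> u"
      using u by simp
  qed
  then show False
    using assms by simp
qed

lemma cohomology_zero: "\<zero>\<^bsub>cohomology X i\<^esub> = coboundaries X i"
  by (simp add: cohomology_def quotient_gmodule_def)

lemma coset_sub_gmodule: "N +>\<^bsub>sub_gmodule M L\<^esub> x = N +>\<^bsub>M\<^esub> x"
  by (simp add: a_r_coset_def' sub_gmodule_def)

lemma cohomology_carrier:
  "carrier (cohomology X i) = (\<lambda>x. coboundaries X i +>\<^bsub>obj X i\<^esub> x) ` cocycles X i"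
  by (auto simp: cohomology_def quotient_gmodule_def A_RCOSETS_def' coset_sub_gmodule)
    (auto simp: sub_gmodule_def)

lemma cohomology_hpart:
  "hpart (cohomology X i) j =
    (\<lambda>x. coboundaries X i +>\<^bsub>obj X i\<^esub> x) ` (hpart (obj X i) j \<inter> cocycles X i)"
  by (simp add: cohomology_def quotient_gmodule_def coset_sub_gmodule) (simp add: sub_gmodule_def)

locale graded_complex = graded_ring A G for A :: "('a, 'c) ring_scheme" and G +
  fixes X :: "('a, 'm) gcomplex"
  assumes complex: "right_bounded_complex A G X"

sublocale graded_complex \<subseteq> C: graded_module A G "obj X i" for i
  using complex
  by (intro graded_module.intro graded_ring_axioms)
    (simp add: right_bounded_complex_def gr_object_def)

context graded_complex
begin

lemma diff_hom: "diff X i \<in> gr_hom A (obj X i) (obj X (i + 1))"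
  using complex by (simp add: right_bounded_complex_def)

lemma diff_closed: "x \<in> carrier (obj X i) \<Longrightarrow> diff X i x \<in> carrier (obj X (i + 1))"
  using diff_hom[of i] by (auto simp: gr_hom_def)

lemma diff_add: "\<lbrakk>x \<in> carrier (obj X i); y \<in> carrier (obj X i)\<rbrakk> \<Longrightarrow>
    diff X i (x \<oplus>\<^bsub>obj X i\<^esub> y) = diff X i x \<oplus>\<^bsub>obj X (i + 1)\<^esub> diff X i y"
  using diff_hom[of i] by (auto simp: gr_hom_def)

lemma diff_smult: "\<lbrakk>a \<in> carrier A; x \<in> carrier (obj X i)\<rbrakk> \<Longrightarrow>
    diff X i (a \<odot>\<^bsub>obj X i\<^esub> x) = a \<odot>\<^bsub>obj X (i + 1)\<^esub> diff X i x"
  using diff_hom[of i] by (auto simp: gr_hom_def)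

lemma diff_part: "x \<in> hpart (obj X i) j \<Longrightarrow> diff X i x \<in> hpart (obj X (i + 1)) j"
  using diff_hom[of i] unfolding gr_hom_def by blast

lemma diff_zero: "diff X i \<zero>\<^bsub>obj X i\<^esub> = \<zero>\<^bsub>obj X (i + 1)\<^esub>"
  using diff_add[of "\<zero>\<^bsub>obj X i\<^esub>" i "\<zero>\<^bsub>obj X i\<^esub>"] diff_closed[of "\<zero>\<^bsub>obj X i\<^esub>" i] by simp

lemma coboundaries_submodule: "submodule (coboundaries X i) A (obj X i)"
proof (rule C.submodule_intro)
  show "coboundaries X i \<subseteq> carrier (obj X i)"
    using diff_closed[of _ "i - 1"] by (auto simp: coboundaries_def)
  show "\<zero>\<^bsub>obj X i\<^esub> \<in> coboundaries X i"
    using diff_zero[of "i - 1"] C.M.zero_closed[of "i - 1"] by (force simp: coboundaries_def)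
  show "x \<oplus>\<^bsub>obj X i\<^esub> y \<in> coboundaries X i" if "x \<in> coboundaries X i" "y \<in> coboundaries X i" for x y
    using that diff_add[of _ "i - 1", symmetric] by (auto simp: coboundaries_def)
  show "a \<odot>\<^bsub>obj X i\<^esub> x \<in> coboundaries X i" if "a \<in> carrier A" "x \<in> coboundaries X i" for a x
    using that diff_smult[of _ _ "i - 1", symmetric] C.lm_smult_closed[of _ _ "i - 1"]
    by (auto simp: coboundaries_def)
qed

lemmas coboundaries_closed = C.submodule_mem[OF coboundaries_submodule]
  and coboundaries_zero = C.submodule_zero[OF coboundaries_submodule]
  and coboundaries_add = C.submodule_add[OF coboundaries_submodule]
  and coboundaries_minus = C.submodule_minus[OF coboundaries_submodule]

lemma cocycles_iff: "x \<in> cocycles X i \<longleftrightarrow> x \<in> carrier (obj X i) \<and> diff X i x = \<zero>\<^bsub>obj X (i + 1)\<^esub>"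
  by (simp add: cocycles_def a_kernel_def')

lemma coset_mem: "x \<in> carrier (obj X i) \<Longrightarrow> x \<in> coboundaries X i +>\<^bsub>obj X i\<^esub> x"
  using coboundaries_zero[of i] by (force simp: a_r_coset_def')

lemma coset_absorb:
  assumes b: "b \<in> coboundaries X i" and x: "x \<in> carrier (obj X i)"
  shows "coboundaries X i +>\<^bsub>obj X i\<^esub> (b \<oplus>\<^bsub>obj X i\<^esub> x) = coboundaries X i +>\<^bsub>obj X i\<^esub> x"
    (is "?B +>\<^bsub>?M\<^esub> _ = _")
proof (intro equalityI subsetI)
  note bc = coboundaries_closed[OF b]
  fix u
  {
    assume "u \<in> ?B +>\<^bsub>?M\<^esub> (b \<oplus>\<^bsub>?M\<^esub> x)"
    then obtain c where c: "c \<in> ?B" "u = c \<oplus>\<^bsub>?M\<^esub> (b \<oplus>\<^bsub>?M\<^esub> x)"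
      by (auto simp: a_r_coset_def')
    then have "u = (c \<oplus>\<^bsub>?M\<^esub> b) \<oplus>\<^bsub>?M\<^esub> x"
      using bc x coboundaries_closed[OF c(1)] by (simp add: C.M.a_assoc)
    then show "u \<in> ?B +>\<^bsub>?M\<^esub> x"
      using coboundaries_add[OF c(1) b] unfolding a_r_coset_def' by blast
  next
    assume "u \<in> ?B +>\<^bsub>?M\<^esub> x"
    then obtain c where c: "c \<in> ?B" "u = c \<oplus>\<^bsub>?M\<^esub> x"
      by (auto simp: a_r_coset_def')
    then have "u = (c \<oplus>\<^bsub>?M\<^esub> (\<ominus>\<^bsub>?M\<^esub> b)) \<oplus>\<^bsub>?M\<^esub> (b \<oplus>\<^bsub>?M\<^esub> x)"
      using bc x coboundaries_closed[OF c(1)] by (simp add: C.M.a_assoc C.M.r_neg1)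
    then show "u \<in> ?B +>\<^bsub>?M\<^esub> (b \<oplus>\<^bsub>?M\<^esub> x)"
      using coboundaries_add[OF c(1) coboundaries_minus[OF b]] unfolding a_r_coset_def' by blast
  }
qed

lemma coset_eq_coboundaries_iff:
  assumes x: "x \<in> carrier (obj X i)"
  shows "coboundaries X i +>\<^bsub>obj X i\<^esub> x = coboundaries X i \<longleftrightarrow> x \<in> coboundaries X i"
proof
  assume b: "x \<in> coboundaries X i"
  have "coboundaries X i +>\<^bsub>obj X i\<^esub> (x \<oplus>\<^bsub>obj X i\<^esub> \<zero>\<^bsub>obj X i\<^esub>) = coboundaries X i +>\<^bsub>obj X i\<^esub> \<zero>\<^bsub>obj X i\<^esub>"
    using coset_absorb[OF b] by simp
  also have "\<dots> = coboundaries X i"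
    using coboundaries_closed by (force simp: a_r_coset_def')
  finally show "coboundaries X i +>\<^bsub>obj X i\<^esub> x = coboundaries X i"
    using x by simp
qed (use coset_mem[OF x] in simp)

lemma component_diff:
  assumes "x \<in> carrier (obj X i)"
  shows "C.MG.comp (i + 1) j (diff X i x) = diff X i (C.MG.comp i j x)"
  by (rule C.gr_hom_component[OF C.graded_module_axioms diff_hom assms])

text \<open>Only the image of \<open>u\<close> has to be homogeneous, not \<open>u\<close> itself.
  This allows the fact to be applied also to an arbitrary preimage of a homogeneous
  coboundary.\<close>

lemma minimal_diff_lowest:
  assumes ss: "semisimple_ring (A\<lparr>carrier := G 0\<rparr>)" and min: "minimal_complex A G X"
    and low: "\<And>i. i < j \<Longrightarrow> hpart (obj X (m + 1)) i = {\<zero>\<^bsub>obj X (m + 1)\<^esub>}"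
    and u: "u \<in> carrier (obj X m)" "diff X m u \<in> hpart (obj X (m + 1)) j"
  shows "diff X m u = \<zero>\<^bsub>obj X (m + 1)\<^esub>"
proof -
  have "diff X m u \<in> ideal_times A (graded_jacobson_radical A G) (obj X (m + 1))"
    using min u(1) by (auto simp: minimal_complex_def)
  from C.component_radical_times_lowest[OF ss low this] show ?thesis
    using C.MG.component_homogeneous[OF u(2), of j] by simp
qed

end

section \<open>Comparison of a complex with its resolution\<close>

locale graded_quasi_isomorphism = P: graded_complex A G P + X: graded_complex A G X
  for A :: "('a, 'c) ring_scheme" and G and P :: "('a, 'p) gcomplex" and X :: "('a, 'm) gcomplex" +
  fixes \<epsilon> :: "int \<Rightarrow> 'p \<Rightarrow> 'm"
  assumes quasi_iso: "quasi_isomorphism A P X \<epsilon>"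
begin

lemma map_hom: "\<epsilon> i \<in> gr_hom A (obj P i) (obj X i)"
  using quasi_iso by (simp add: quasi_isomorphism_def chain_map_def)

lemma map_closed: "x \<in> carrier (obj P i) \<Longrightarrow> \<epsilon> i x \<in> carrier (obj X i)"
  using map_hom[of i] by (auto simp: gr_hom_def)

lemma map_add: "\<lbrakk>x \<in> carrier (obj P i); y \<in> carrier (obj P i)\<rbrakk> \<Longrightarrow>
    \<epsilon> i (x \<oplus>\<^bsub>obj P i\<^esub> y) = \<epsilon> i x \<oplus>\<^bsub>obj X i\<^esub> \<epsilon> i y"
  using map_hom[of i] by (auto simp: gr_hom_def)

lemma map_zero: "\<epsilon> i \<zero>\<^bsub>obj P i\<^esub> = \<zero>\<^bsub>obj X i\<^esub>"
  using map_add[of "\<zero>\<^bsub>obj P i\<^esub>" i "\<zero>\<^bsub>obj P i\<^esub>"] map_closed[of "\<zero>\<^bsub>obj P i\<^esub>" i] by simp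

lemma map_part: "x \<in> hpart (obj P i) j \<Longrightarrow> \<epsilon> i x \<in> hpart (obj X i) j"
  using map_hom[of i] unfolding gr_hom_def by blast

lemma map_diff: "x \<in> carrier (obj P i) \<Longrightarrow> \<epsilon> (i + 1) (diff P i x) = diff X i (\<epsilon> i x)"
  using quasi_iso by (simp add: quasi_isomorphism_def chain_map_def)

lemma map_cocycle: "x \<in> cocycles P i \<Longrightarrow> \<epsilon> i x \<in> cocycles X i"
  using map_closed map_diff map_zero by (simp add: P.cocycles_iff X.cocycles_iff flip: map_diff)

lemma map_coboundary: "x \<in> coboundaries P i \<Longrightarrow> \<epsilon> i x \<in> coboundaries X i"
  using map_diff[of _ "i - 1"] map_closed[of _ "i - 1"] by (auto simp: coboundaries_def)

text \<open>The union defining \<open>cohomology_map\<close> collapses, since representatives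
  differing by a coboundary have images differing by a coboundary.\<close>

lemma cohomology_map_coset:
  assumes x: "x \<in> carrier (obj P i)"
  shows "cohomology_map X \<epsilon> i (coboundaries P i +>\<^bsub>obj P i\<^esub> x) = coboundaries X i +>\<^bsub>obj X i\<^esub> \<epsilon> i x"
proof -
  have "coboundaries X i +>\<^bsub>obj X i\<^esub> \<epsilon> i u = coboundaries X i +>\<^bsub>obj X i\<^esub> \<epsilon> i x"
    if u: "u \<in> coboundaries P i +>\<^bsub>obj P i\<^esub> x" for u
  proof -
    obtain b where b: "b \<in> coboundaries P i" "u = b \<oplus>\<^bsub>obj P i\<^esub> x"
      using u by (auto simp: a_r_coset_def')
    then have "\<epsilon> i u = \<epsilon> i b \<oplus>\<^bsub>obj X i\<^esub> \<epsilon> i x"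
      using map_add[OF P.coboundaries_closed[OF b(1)] x] by simp
    then show ?thesis
      using X.coset_absorb[OF map_coboundary[OF b(1)] map_closed[OF x]] by simp
  qed
  then show ?thesis
    unfolding cohomology_map_def using P.coset_mem[OF x] by blast
qed

lemma cohomology_bij:
  "bij_betw (cohomology_map X \<epsilon> i) (carrier (cohomology P i)) (carrier (cohomology X i))"
  using quasi_iso by (simp add: quasi_isomorphism_def)

text \<open>Injectivity on cohomology: the class of \<open>\<epsilon> i x\<close> lies in a
  vanishing graded piece, so the class of \<open>x\<close> is zero as well.\<close>

lemma cocycle_coboundary:
  assumes H: "hpart (cohomology X i) j = {\<zero>\<^bsub>cohomology X i\<^esub>}"
    and x: "x \<in> hpart (obj P i) j" "x \<in> cocycles P i"
  shows "x \<in> coboundaries P i"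
proof -
  have xc: "x \<in> carrier (obj P i)"
    using x(2) by (simp add: P.cocycles_iff)
  have z: "\<zero>\<^bsub>obj P i\<^esub> \<in> cocycles P i"
    by (simp add: P.cocycles_iff P.diff_zero)
  have "coboundaries X i +>\<^bsub>obj X i\<^esub> \<epsilon> i x \<in> hpart (cohomology X i) j"
    using map_part[OF x(1)] map_cocycle[OF x(2)] by (simp add: cohomology_hpart)
  then have "coboundaries X i +>\<^bsub>obj X i\<^esub> \<epsilon> i x = coboundaries X i"
    using H by (simp add: cohomology_zero)
  also have "\<dots> = coboundaries X i +>\<^bsub>obj X i\<^esub> \<epsilon> i \<zero>\<^bsub>obj P i\<^esub>"
    using X.coset_eq_coboundaries_iff[of "\<zero>\<^bsub>obj X i\<^esub>" i] X.coboundaries_zero by (simp add: map_zero)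
  finally have "cohomology_map X \<epsilon> i (coboundaries P i +>\<^bsub>obj P i\<^esub> x) =
      cohomology_map X \<epsilon> i (coboundaries P i +>\<^bsub>obj P i\<^esub> \<zero>\<^bsub>obj P i\<^esub>)"
    using xc by (simp add: cohomology_map_coset)
  then have "coboundaries P i +>\<^bsub>obj P i\<^esub> x = coboundaries P i +>\<^bsub>obj P i\<^esub> \<zero>\<^bsub>obj P i\<^esub>"
    using bij_betw_imp_inj_on[OF cohomology_bij] x(2) z
    by (auto simp: cohomology_carrier dest: inj_onD)
  also have "\<dots> = coboundaries P i"
    using P.coset_eq_coboundaries_iff[of "\<zero>\<^bsub>obj P i\<^esub>" i] P.coboundaries_zero by simp
  finally show ?thesis
    using P.coset_eq_coboundaries_iff[OF xc] by simp
qed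

text \<open>Surjectivity on cohomology: a class of degree \<open>j\<close> is hit by some cocycle
  \<open>u\<close>. If the degree \<open>j\<close> part of \<open>P\<close> were zero,
  \<open>\<epsilon> i u\<close> would have no \<open>j\<close>-th component, and every such class
  would be trivial.\<close>

lemma hpart_nonzero:
  assumes H: "hpart (cohomology X i) j \<noteq> {\<zero>\<^bsub>cohomology X i\<^esub>}"
  shows "hpart (obj P i) j \<noteq> {\<zero>\<^bsub>obj P i\<^esub>}"
proof
  assume z: "hpart (obj P i) j = {\<zero>\<^bsub>obj P i\<^esub>}"
  have "x \<in> coboundaries X i" if x: "x \<in> hpart (obj X i) j" "x \<in> cocycles X i" for x
  proof -
    have xc: "x \<in> carrier (obj X i)"
      using x(2) by (simp add: X.cocycles_iff)
    have "coboundaries X i +>\<^bsub>obj X i\<^esub> x \<in> carrier (cohomology X i)"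
      using x(2) by (simp add: cohomology_carrier)
    then have "coboundaries X i +>\<^bsub>obj X i\<^esub> x \<in> cohomology_map X \<epsilon> i ` carrier (cohomology P i)"
      using bij_betw_imp_surj_on[OF cohomology_bij[of i]] by simp
    then obtain u where u: "u \<in> cocycles P i"
      "cohomology_map X \<epsilon> i (coboundaries P i +>\<^bsub>obj P i\<^esub> u) = coboundaries X i +>\<^bsub>obj X i\<^esub> x"
      unfolding cohomology_carrier[of P] by force
    have uc: "u \<in> carrier (obj P i)"
      using u(1) by (simp add: P.cocycles_iff)
    have "x \<in> coboundaries X i +>\<^bsub>obj X i\<^esub> \<epsilon> i u"
      using u(2) X.coset_mem[OF xc] uc by (simp add: cohomology_map_coset)
    then obtain b where b: "b \<in> coboundaries X i" "x = b \<oplus>\<^bsub>obj X i\<^esub> \<epsilon> i u"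
      by (auto simp: a_r_coset_def')
    then obtain v where v: "v \<in> carrier (obj X (i - 1))" "b = diff X (i - 1) v"
      by (auto simp: coboundaries_def)
    have bc: "b \<in> carrier (obj X i)"
      using X.coboundaries_closed[OF b(1)] .
    have "X.C.MG.comp i j (\<epsilon> i u) = \<epsilon> i (P.C.MG.comp i j u)"
      by (rule P.C.gr_hom_component[OF X.C.graded_module_axioms map_hom uc])
    also have "\<dots> = \<zero>\<^bsub>obj X i\<^esub>"
      using P.C.MG.component_part[OF uc, of j] z by (simp add: map_zero)
    finally have eu: "X.C.MG.comp i j (\<epsilon> i u) = \<zero>\<^bsub>obj X i\<^esub>" .
    \<comment> \<open>Neither \<open>u\<close> nor \<open>v\<close> need be homogeneous; passing to
      \<open>j\<close>-th components removes \<open>\<epsilon> i u\<close> and exhibits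
      \<open>x\<close> as the differential of the \<open>j\<close>-th component of
      \<open>v\<close>.\<close>
    have "x = X.C.MG.comp i j x"
      using X.C.MG.component_homogeneous[OF x(1), of j] by simp
    also have "\<dots> = X.C.MG.comp i j b"
      using X.C.MG.component_add[OF bc map_closed[OF uc], of j] X.C.MG.component_closed[OF bc, of j]
      by (simp add: b(2) eu)
    also have "\<dots> = diff X (i - 1) (X.C.MG.comp (i - 1) j v)"
      using X.component_diff[OF v(1), of j] v(2) by simp
    finally show ?thesis
      using X.C.MG.component_closed[OF v(1)] by (auto simp: coboundaries_def)
  qed
  then have "coboundaries X i +>\<^bsub>obj X i\<^esub> x = coboundaries X i"
    if "x \<in> hpart (obj X i) j \<inter> cocycles X i" for x
    using that X.coset_eq_coboundaries_iff[of x i] by (simp add: X.cocycles_iff)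
  then have "hpart (cohomology X i) j \<subseteq> {coboundaries X i}"
    unfolding cohomology_hpart by blast
  moreover have "\<zero>\<^bsub>obj X i\<^esub> \<in> hpart (obj X i) j \<inter> cocycles X i"
    using X.C.MG.part_zero by (simp add: X.cocycles_iff X.diff_zero)
  ultimately show False
    using H unfolding cohomology_hpart cohomology_zero by blast
qed

end

lemma (in graded_quasi_isomorphism) minimal_hpart_vanish:
  assumes ss: "semisimple_ring (A\<lparr>carrier := G 0\<rparr>)" and min: "minimal_complex A G P"
    and H: "\<And>i j. i + j < d \<Longrightarrow> hpart (cohomology X i) j = {\<zero>\<^bsub>cohomology X i\<^esub>}"
    and "m + j < d"
  shows "hpart (obj P m) j = {\<zero>\<^bsub>obj P m\<^esub>}"
proof -
  obtain n where n: "\<And>i. i > n \<Longrightarrow> carrier (obj P i) = {\<zero>\<^bsub>obj P i\<^esub>}"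
    using P.complex by (auto simp: right_bounded_complex_def)
  have zero: "hpart (obj P m) j = {\<zero>\<^bsub>obj P m\<^esub>}" if "m > n" for m j
    using n[OF that] P.C.MG.part_zero P.C.MG.part_closed by blast
  \<comment> \<open>The descending induction on \<open>m\<close> is run over a natural number
    \<open>k\<close>; for \<open>k = 0\<close> only positions above \<open>n\<close> remain, where
    the complex is zero.\<close>
  have "\<forall>m j. n + 1 - int k \<le> m \<longrightarrow> m + j < d \<longrightarrow> hpart (obj P m) j = {\<zero>\<^bsub>obj P m\<^esub>}" for k
  proof (induction k)
    case 0
    then show ?case
      using zero by simp
  next
    case (Suc k)
    show ?case
    proof (intro allI impI, rule ccontr)
      fix m j assume m: "n + 1 - int (Suc k) \<le> m" and mj: "m + j < d"
        and nz: "hpart (obj P m) j \<noteq> {\<zero>\<^bsub>obj P m\<^esub>}"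
      have above: "hpart (obj P (m + 1)) i = {\<zero>\<^bsub>obj P (m + 1)\<^esub>}" if "m + 1 + i < d" for i
        using Suc.IH m that by simp
      have "fin_gen A (obj P m) (carrier (obj P m))"
        using P.complex by (simp add: right_bounded_complex_def gr_object_def)
      then obtain b where b: "\<And>i. i < b \<Longrightarrow> hpart (obj P m) i = {\<zero>\<^bsub>obj P m\<^esub>}"
        using P.C.bounded_below by blast
      obtain i where i: "i \<le> j" "hpart (obj P m) i \<noteq> {\<zero>\<^bsub>obj P m\<^esub>}"
        and low: "\<And>l. l < i \<Longrightarrow> hpart (obj P m) l = {\<zero>\<^bsub>obj P m\<^esub>}"
      proof -
        \<comment> \<open>Degrees are integers, so a least one is found by measuring natural offsets
          from the lower bound \<open>b\<close>.\<close>
        let ?Q = "\<lambda>l::nat. hpart (obj P m) (b + int l) \<noteq> {\<zero>\<^bsub>obj P m\<^esub>}"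
        have "b \<le> j"
          using b[of j] nz by force
        then have Q: "?Q (nat (j - b))"
          using nz by simp
        let ?l = "LEAST l. ?Q l"
        have "b + int ?l \<le> j"
          using Least_le[of ?Q, OF Q] \<open>b \<le> j\<close> by linarith
        moreover have "hpart (obj P m) l = {\<zero>\<^bsub>obj P m\<^esub>}" if "l < b + int ?l" for l
        proof (cases "l < b")
          case False
          then have "nat (l - b) < ?l"
            using that by linarith
          from not_less_Least[OF this] show ?thesis
            using False by simp
        qed (rule b)
        ultimately show ?thesis
          using that[of "b + int ?l"] LeastI[of ?Q, OF Q] by blast
      qed
      obtain x where x: "x \<in> hpart (obj P m) i" "x \<noteq> \<zero>\<^bsub>obj P m\<^esub>"
        using i(2) P.C.MG.part_zero by blast
      have xc: "x \<in> carrier (obj P m)"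
        using P.C.MG.part_closed[OF x(1)] .
      \<comment> \<open>A degree \<open>l < i\<close> satisfies
        \<open>m + 1 + l \<le> m + j < d\<close>, so the gain of one in cohomological degree is
        compensated and \<open>above\<close> applies.\<close>
      have "diff P m x = \<zero>\<^bsub>obj P (m + 1)\<^esub>"
        by (rule P.minimal_diff_lowest[OF ss min _ xc P.diff_part[OF x(1)]])
          (use above i(1) mj in simp)
      then have "x \<in> cocycles P m"
        using xc by (simp add: P.cocycles_iff)
      then have "x \<in> coboundaries P m"
        using cocycle_coboundary[OF H x(1)] i(1) mj by simp
      then obtain u where u: "u \<in> carrier (obj P (m - 1))" "x = diff P (m - 1) u"
        by (auto simp: coboundaries_def)
      \<comment> \<open>Minimality again, one position to the left: the image of \<open>u\<close> is
        \<open>x\<close>, which sits in the lowest degree \<open>i\<close> of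
        \<open>obj P m\<close>.\<close>
      have "diff P (m - 1) u = \<zero>\<^bsub>obj P (m - 1 + 1)\<^esub>"
        by (rule P.minimal_diff_lowest[OF ss min _ u(1), of i]) (use low x(1) u(2) in simp_all)
      then show False
        using x(2) u(2) by simp
    qed
  qed
  from this[of "nat (n + 1 - m)"] show ?thesis
    using assms(4) by simp
qed

theorem lemma4p7:
  fixes K :: "('k, 'c) ring_scheme"
    and A :: "('k, 'a, 'd) module_scheme"
    and G :: "nat \<Rightarrow> 'a set"
    and X :: "('a, 'm) gcomplex"
    and P :: "('a, 'p) gcomplex"
    and \<epsilon> :: "int \<Rightarrow> 'p \<Rightarrow> 'm"
    and p :: int
  assumes "locally_finite_graded_algebra K A G"
    and "noetherian A"
    and "semisimple_ring (A\<lparr>carrier := G 0\<rparr>)"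
    and "right_bounded_complex A G X"
    and "\<not> zero_in_derived A X"
    and "graded_projective_resolution A G X P \<epsilon>"
    and "minimal_complex A G P"
    and "ereal (real_of_int p) = - inf_deg X"
  shows "\<exists>\<alpha> Q x.
     direct_summand A (obj P (- \<alpha>)) Q \<and>
     indecomposable A (obj P (- \<alpha>)) Q \<and>
     x \<in> hpart (obj P (- \<alpha>)) (\<alpha> - p) \<and>
     Q = gen_submodule A (obj P (- \<alpha>)) {x} \<and>
     x \<in> a_kernel (obj P (- \<alpha>)) (obj P (- \<alpha> + 1)) (diff P (- \<alpha>))"
proof -
  note ss = assms(3) and min = assms(7)
  have P: "right_bounded_complex A G P" "\<And>i. graded_projective A G (obj P i)"
    "quasi_isomorphism A P X \<epsilon>"
    using assms(6) by (auto simp: graded_projective_resolution_def)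
  have gr: "graded_ring A G"
    by (rule locally_finite_graded_algebra.graded_ring[OF assms(1)])
  interpret graded_quasi_isomorphism A G P X \<epsilon>
    by (intro graded_quasi_isomorphism.intro graded_complex.intro graded_complex_axioms.intro
        graded_quasi_isomorphism_axioms.intro gr P assms(4))
  have "inf_deg X = - ereal (real_of_int p)"
    using assms(8) by simp
  then have d: "inf_deg X = ereal (real_of_int (- p))"
    by simp
  have H: "hpart (cohomology X i) j = {\<zero>\<^bsub>cohomology X i\<^esub>}" if "i + j < - p" for i j
  proof (rule ccontr)
    assume "\<not> ?thesis"
    from inf_deg_le[OF this] show False
      using d that by simp
  qed
  have vanish: "hpart (obj P m) j = {\<zero>\<^bsub>obj P m\<^esub>}" if "m + j < - p" for m j
    using minimal_hpart_vanish[OF ss min H that] .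
  \<comment> \<open>An integer infimum is attained, which supplies a nonzero cohomology class in
    total degree \<open>- p\<close>.\<close>
  obtain i j where ij: "i + j = - p" "hpart (cohomology X i) j \<noteq> {\<zero>\<^bsub>cohomology X i\<^esub>}"
    using inf_deg_attained[OF d] .
  define S where "S = {m. hpart (obj P m) (- p - m) \<noteq> {\<zero>\<^bsub>obj P m\<^esub>}}"
  have "- p - i = j"
    using ij(1) by simp
  then have iS: "i \<in> S"
    using hpart_nonzero[OF ij(2)] by (simp add: S_def)
  obtain n where n: "\<And>i. i > n \<Longrightarrow> carrier (obj P i) = {\<zero>\<^bsub>obj P i\<^esub>}"
    using P(1) by (auto simp: right_bounded_complex_def)
  have S_le: "m \<le> n" if "m \<in> S" for m
  proof (rule ccontr)
    assume "\<not> m \<le> n"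
    then have "hpart (obj P m) (- p - m) = {\<zero>\<^bsub>obj P m\<^esub>}"
      using n[of m] P.C.MG.part_zero P.C.MG.part_closed by force
    then show False
      using that by (simp add: S_def)
  qed
  obtain m where m: "m \<in> S" "\<And>l. l \<in> S \<Longrightarrow> l \<le> m"
  proof -
    \<comment> \<open>\<open>S\<close> may be unbounded below; cutting it off at its known member
      \<open>i\<close> makes it finite without losing the maximum.\<close>
    have "finite (S \<inter> {i..n})"
      by simp
    moreover have "i \<in> S \<inter> {i..n}"
      using iS S_le by simp
    ultimately have "Max (S \<inter> {i..n}) \<in> S \<inter> {i..n}" "\<And>l. l \<in> S \<inter> {i..n} \<Longrightarrow> l \<le> Max (S \<inter> {i..n})"
      using Max_in Max_ge by blast+
    then show ?thesis
      using that[of "Max (S \<inter> {i..n})"] S_le by (metis Int_iff atLeastAtMost_iff linear order_trans)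
  qed
  let ?j = "- p - m"
  have low: "hpart (obj P m) l = {\<zero>\<^bsub>obj P m\<^esub>}" if "l < ?j" for l
    using vanish that by simp
  have low': "hpart (obj P (m + 1)) l = {\<zero>\<^bsub>obj P (m + 1)\<^esub>}" if "l < ?j" for l
  \<comment> \<open>For \<open>l = ?j - 1\<close> the total degree in position \<open>m + 1\<close>
    is exactly \<open>- p\<close>, which \<open>vanish\<close> does not reach; this single case is
    covered by maximality of \<open>m\<close>. Smaller \<open>l\<close> fall strictly below
    \<open>- p\<close>.\<close>
  proof (cases "l = ?j - 1")
    case True
    then have l: "l = - p - (m + 1)"
      by simp
    have "m + 1 \<notin> S"
      using m(2) by force
    then show ?thesis
      unfolding S_def l by simp
  next
    case False
    then show ?thesis
      using vanish that by simp
  qed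
  obtain y where y: "y \<in> hpart (obj P m) ?j" "direct_summand A (obj P m) (gen_submodule A (obj P m) {y})"
      "indecomposable A (obj P m) (gen_submodule A (obj P m) {y})"
    using P.C.projective_lowest_summand[OF ss P(2) low] m(1) unfolding S_def by blast
  have yc: "y \<in> carrier (obj P m)"
    using P.C.MG.part_closed[OF y(1)] .
  have "diff P m y = \<zero>\<^bsub>obj P (m + 1)\<^esub>"
    by (rule P.minimal_diff_lowest[OF ss min low' yc P.diff_part[OF y(1)]])
  then have "y \<in> a_kernel (obj P m) (obj P (m + 1)) (diff P m)"
    using yc by (simp add: a_kernel_def')
  moreover have "y \<in> hpart (obj P m) (- m - p)"
    using y(1) by (metis minus_diff_commute)
  \<comment> \<open>With \<open>\<alpha> = - m\<close>, the degree \<open>- p - m\<close> of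
    \<open>y\<close> reads \<open>\<alpha> - p\<close>.\<close>
  ultimately show ?thesis
    using y(2,3) by (intro exI[of _ "- m"] exI[of _ "gen_submodule A (obj P m) {y}"] exI[of _ y]) simp
qed

end
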